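(* Let $\mathbb{K}$ be an algebraically closed field, $M$ a lattice, and $A=\bigoplus_{u\in M}A_u$ a finitely generated, integral, $M$-graded $\mathbb{K}$-algebra with weight cone $\omega(A)$ and GIT-fan $\Lambda(A)$. (i) If $u,v\in\omega(A)\cap M$ is a generating pair, then the weights $u,v$ lie in a common GIT-cone $\lambda\in\Lambda(A)$. (ii) If $u,v\in\omega(A)\cap M$ lie in a common GIT-cone $\lambda\in\Lambda(A)$ and $u$ belongs to the relative interior $\lambda^\circ\subseteq\lambda$, then $u,v$ is a generating pair.
   Context: Algebras are associative, commutative, with unit; integral means being an integral domain. A lattice is a group $M\cong\mathbb{Z}^d$. Weight cone: $\omega(A)\subseteq\mathbb{Q}\otimes_{\mathbb{Z}}M$ is the convex polyhedral cone generated by all $u\in M$ with $A_u\neq 0$. Generating pair: a pair $u,v\in\omega(A)\cap M$ is called generating if there exists an integer $m>0$ such that for every integer $k>0$ the multiplication map $A_{kmu}\otimes_{\mathbb{K}}A_{kmv}\to A_{km(u+v)}$, $f\otimes g\mapsto fg$, is surjective. Orbit cones: let $X:=\mathrm{Spec}(A)$. For a closed point $x\in X$, the orbit cone $\omega(x)\subseteq\mathbb{Q}\otimes_{\mathbb{Z}}M$ is the convex polyhedral cone generated by all $u\in\omega(A)\cap M$ admitting an $f\in A_u$ with $f(x)\neq 0$. There are only finitely many orbit cones. GIT-cones and GIT-fan: for $u\in\omega(A)$, the GIT-cone of $u$ is $\lambda(u):=\bigcap_{x\in X,\ u\in\omega(x)}\omega(x)$. The GIT-fan $\Lambda(A)$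 is the collection of all GIT-cones $\lambda(u)$, $u\in\omega(A)$; it is a fan (possibly with cones containing lines) whose cones cover $\omega(A)$. *)

theory Defs
  imports "HOL-Computational_Algebra.Polynomial"
begin

section \<open>Lattices\<close>

definition int_scale :: "int \<Rightarrow> 'm::ab_group_add \<Rightarrow> 'm" (infixr "\<cdot>\<^sub>Z" 75)
  where "n \<cdot>\<^sub>Z u = (if 0 \<le> n then (\<Sum>i<nat n. u) else - (\<Sum>i<nat (- n). u))"

lemma int_scale_diff:
  "(int m - int n) \<cdot>\<^sub>Z u = (\<Sum>i<m. u) - (\<Sum>i<n. u)" for u :: "'m::ab_group_add"
proof -
  have add: "(\<Sum>i<a + b. u) = (\<Sum>i<a. u) + (\<Sum>i<b. u)" for a b :: nat
    by (induction b) (simp_all add: algebra_simps)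
  show ?thesis
  proof (cases "n \<le> m")
    case True
    then obtain d where "m = n + d" using le_Suc_ex by blast
    then show ?thesis by (simp add: int_scale_def add)
  next
    case False
    then obtain d where d: "n = m + d" "d > 0" using less_imp_add_positive[of m n] by auto
    then show ?thesis by (simp add: int_scale_def add)
  qed
qed

interpretation int_mod: module "int_scale :: int \<Rightarrow> 'm::ab_group_add \<Rightarrow> 'm"
proof
  fix a b :: int and u v :: 'm
  obtain m n where a: "a = int m - int n" by (rule int_diff_cases)
  obtain p q where b: "b = int p - int q" by (rule int_diff_cases)
  have add: "(\<Sum>i<c + d. x) = (\<Sum>i<c. x) + (\<Sum>i<d. x)" for c d :: nat and x :: 'm
    by (induction d) (simp_all add: algebra_simps)
  have mult: "(\<Sum>i<c. \<Sum>j<d. x) = (\<Sum>i<c * d. x)" for c d :: nat and x :: 'm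
    by (induction c) (simp_all add: add add.commute)
  show "a \<cdot>\<^sub>Z (u + v) = a \<cdot>\<^sub>Z u + a \<cdot>\<^sub>Z v"
    by (simp add: a int_scale_diff sum.distrib)
  have "a + b = int (m + p) - int (n + q)" by (simp add: a b)
  then show "(a + b) \<cdot>\<^sub>Z u = a \<cdot>\<^sub>Z u + b \<cdot>\<^sub>Z u"
    by (simp only: int_scale_diff a b) (simp add: add)
  have "a * b = int (m * p + n * q) - int (m * q + n * p)"
    by (simp add: a b algebra_simps)
  then show "a \<cdot>\<^sub>Z (b \<cdot>\<^sub>Z u) = (a * b) \<cdot>\<^sub>Z u"
    by (simp only: int_scale_diff a b) (simp add: add sum_subtractf mult)
  show "1 \<cdot>\<^sub>Z u = u"
    by (simp add: int_scale_def)
qed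

definition is_lattice :: "'m::ab_group_add itself \<Rightarrow> bool"
  where "is_lattice _ \<longleftrightarrow>
    (\<exists>(d::nat) (\<phi> :: 'm \<Rightarrow> nat \<Rightarrow> int).
       bij_betw \<phi> UNIV {c. \<forall>i\<ge>d. c i = 0} \<and> (\<forall>u v i. \<phi> (u + v) i = \<phi> u i + \<phi> v i))"


section \<open>The rational vector space \<open>\<rat> \<otimes> M\<close>\<close>

text \<open>
  \<open>\<rat> \<otimes> M\<close> is constructed as the localization of the abelian group \<open>M\<close> at the nonzero
  integers: the pair \<open>(u, n)\<close> represents \<open>(1/n) \<otimes> u\<close>.
\<close>

definition qtensor_rel :: "'m::ab_group_add \<times> int \<Rightarrow> 'm \<times> int \<Rightarrow> bool"
  where "qtensor_rel = (\<lambda>x y. snd x \<noteq> 0 \<and> snd y \<noteq> 0 \<and>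
    (\<exists>k. k \<noteq> 0 \<and> k \<cdot>\<^sub>Z snd y \<cdot>\<^sub>Z fst x = k \<cdot>\<^sub>Z snd x \<cdot>\<^sub>Z fst y))"

lemma qtensor_relI:
  "n \<noteq> 0 \<Longrightarrow> m \<noteq> 0 \<Longrightarrow> k \<noteq> 0 \<Longrightarrow> (k * m) \<cdot>\<^sub>Z u = (k * n) \<cdot>\<^sub>Z v \<Longrightarrow> qtensor_rel (u, n) (v, m)"
  unfolding qtensor_rel_def by auto

lemma qtensor_relE:
  assumes "qtensor_rel (u, n) (v, m)"
  obtains k where "n \<noteq> 0" "m \<noteq> 0" "k \<noteq> 0" "(k * m) \<cdot>\<^sub>Z u = (k * n) \<cdot>\<^sub>Z v"
  using assms unfolding qtensor_rel_def by auto

lemma int_scale_mult_cong: "a \<cdot>\<^sub>Z u = b \<cdot>\<^sub>Z v \<Longrightarrow> (c * a) \<cdot>\<^sub>Z u = (c * b) \<cdot>\<^sub>Z v"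
  by (metis int_mod.scale_scale)

lemma part_equivp_qtensor_rel: "part_equivp (qtensor_rel :: 'm::ab_group_add \<times> int \<Rightarrow> _)"
proof (rule part_equivpI)
  show "\<exists>x :: 'm \<times> int. qtensor_rel x x"
    by (rule exI[of _ "(0, 1)"], rule qtensor_relI[of _ _ 1]) auto
  show "symp (qtensor_rel :: 'm \<times> int \<Rightarrow> _)"
    unfolding symp_def qtensor_rel_def by metis
  show "transp (qtensor_rel :: 'm \<times> int \<Rightarrow> _)"
  proof (rule transpI, unfold split_paired_all)
    fix u v w :: 'm and a b c :: int
    assume 1: "qtensor_rel (u, a) (v, b)" and 2: "qtensor_rel (v, b) (w, c)"
    obtain k where k: "a \<noteq> 0" "b \<noteq> 0" "k \<noteq> 0" "(k * b) \<cdot>\<^sub>Z u = (k * a) \<cdot>\<^sub>Z v"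
      using 1 by (rule qtensor_relE)
    obtain l where l: "c \<noteq> 0" "l \<noteq> 0" "(l * c) \<cdot>\<^sub>Z v = (l * b) \<cdot>\<^sub>Z w"
      using 2 by (rule qtensor_relE)
    have "(l * c * (k * b)) \<cdot>\<^sub>Z u = (k * a * (l * c)) \<cdot>\<^sub>Z v"
      using int_scale_mult_cong[OF k(4), of "l * c"] by (simp add: mult_ac)
    also have "\<dots> = (k * a * (l * b)) \<cdot>\<^sub>Z w"
      by (rule int_scale_mult_cong[OF l(3)])
    finally show "qtensor_rel (u, a) (w, c)"
      using k l by (intro qtensor_relI[of _ _ "k * l * b"]) (auto simp: mult_ac)
  qed
qed

quotient_type (overloaded) 'm qtensor = "'m::ab_group_add \<times> int" / partial: qtensor_rel
  by (rule part_equivp_qtensor_rel)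

instantiation qtensor :: (ab_group_add) ab_group_add
begin

lift_definition zero_qtensor :: "'a qtensor" is "(0, 1)"
  by (rule qtensor_relI[of _ _ 1]) auto

lift_definition plus_qtensor :: "'a qtensor \<Rightarrow> 'a qtensor \<Rightarrow> 'a qtensor"
  is "\<lambda>(u, n) (v, m). (m \<cdot>\<^sub>Z u + n \<cdot>\<^sub>Z v, n * m)"
proof (clarify)
  fix u u' v v' :: 'a and n n' m m' :: int
  assume 1: "qtensor_rel (u, n) (u', n')" and 2: "qtensor_rel (v, m) (v', m')"
  obtain k where k: "n \<noteq> 0" "n' \<noteq> 0" "k \<noteq> 0" "(k * n') \<cdot>\<^sub>Z u = (k * n) \<cdot>\<^sub>Z u'"
    using 1 by (rule qtensor_relE)
  obtain l where l: "m \<noteq> 0" "m' \<noteq> 0" "l \<noteq> 0" "(l * m') \<cdot>\<^sub>Z v = (l * m) \<cdot>\<^sub>Z v'"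
    using 2 by (rule qtensor_relE)
  have "(l * m * m' * (k * n')) \<cdot>\<^sub>Z u = (l * m * m' * (k * n)) \<cdot>\<^sub>Z u'"
       "(k * n * n' * (l * m')) \<cdot>\<^sub>Z v = (k * n * n' * (l * m)) \<cdot>\<^sub>Z v'"
    using k l by (auto intro: int_scale_mult_cong)
  then show "qtensor_rel (m \<cdot>\<^sub>Z u + n \<cdot>\<^sub>Z v, n * m) (m' \<cdot>\<^sub>Z u' + n' \<cdot>\<^sub>Z v', n' * m')"
    using k l by (intro qtensor_relI[of _ _ "k * l"])
      (auto simp: int_mod.scale_right_distrib mult_ac)
qed

lift_definition uminus_qtensor :: "'a qtensor \<Rightarrow> 'a qtensor" is "\<lambda>(u, n). (- u, n)"
  by (auto elim!: qtensor_relE intro: qtensor_relI)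

definition minus_qtensor :: "'a qtensor \<Rightarrow> 'a qtensor \<Rightarrow> 'a qtensor"
  where "minus_qtensor x y = x + - y"

instance
proof
  fix x y z :: "'a qtensor"
  show "x + y + z = x + (y + z)"
  proof (transfer, unfold split_paired_all, clarsimp)
    fix u v w :: 'a and a b c :: int
    assume "qtensor_rel (u, a) (u, a)" "qtensor_rel (v, b) (v, b)" "qtensor_rel (w, c) (w, c)"
    then show "qtensor_rel (c \<cdot>\<^sub>Z (b \<cdot>\<^sub>Z u + a \<cdot>\<^sub>Z v) + (a * b) \<cdot>\<^sub>Z w, a * b * c)
        ((b * c) \<cdot>\<^sub>Z u + a \<cdot>\<^sub>Z (c \<cdot>\<^sub>Z v + b \<cdot>\<^sub>Z w), a * (b * c))"
      by (auto elim!: qtensor_relE intro!: qtensor_relI[of _ _ 1]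
        simp: int_mod.scale_right_distrib mult_ac add_ac)
  qed
  show "x + y = y + x"
    by transfer (auto elim!: qtensor_relE intro!: qtensor_relI[of _ _ 1] simp: mult_ac add_ac)
  show "0 + x = x"
    by transfer (auto elim!: qtensor_relE intro!: qtensor_relI[of _ _ 1])
  show "- x + x = 0"
    by transfer (auto elim!: qtensor_relE intro!: qtensor_relI[of _ _ 1])
  show "x - y = x + - y"
    by (fact minus_qtensor_def)
qed

end

lift_definition rat_scale :: "rat \<Rightarrow> 'm::ab_group_add qtensor \<Rightarrow> 'm qtensor" (infixr "\<cdot>\<^sub>Q" 75)
  is "\<lambda>q (u, n). (fst (quotient_of q) \<cdot>\<^sub>Z u, snd (quotient_of q) * n)"
proof (clarify)
  fix q :: rat and u v :: 'm and n m :: int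
  assume "qtensor_rel (u, n) (v, m)"
  then obtain k where k: "n \<noteq> 0" "m \<noteq> 0" "k \<noteq> 0" "(k * m) \<cdot>\<^sub>Z u = (k * n) \<cdot>\<^sub>Z v"
    by (rule qtensor_relE)
  define a b where "a = fst (quotient_of q)" and "b = snd (quotient_of q)"
  have b: "b \<noteq> 0" using quotient_of_denom_pos'[of q] by (simp add: b_def)
  have "(a * b * (k * m)) \<cdot>\<^sub>Z u = (a * b * (k * n)) \<cdot>\<^sub>Z v"
    by (rule int_scale_mult_cong[OF k(4)])
  then have "qtensor_rel (a \<cdot>\<^sub>Z u, b * n) (a \<cdot>\<^sub>Z v, b * m)"
    using k b by (intro qtensor_relI[of _ _ k]) (auto simp: mult_ac)
  then show "qtensor_rel (fst (quotient_of q) \<cdot>\<^sub>Z u, snd (quotient_of q) * n)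
      (fst (quotient_of q) \<cdot>\<^sub>Z v, snd (quotient_of q) * m)"
    by (simp add: a_def b_def)
qed

lemma rat_eq_cross:
  assumes "q = of_int a / of_int b" "b \<noteq> 0"
  shows "fst (quotient_of q) * b = a * snd (quotient_of q)"
proof -
  have "snd (quotient_of q) \<noteq> 0" using quotient_of_denom_pos'[of q] by simp
  moreover have "of_int a / of_int b = (of_int (fst (quotient_of q)) / of_int (snd (quotient_of q)) :: rat)"
    by (simp add: quotient_of_div flip: assms(1))
  ultimately have "of_int (fst (quotient_of q) * b) = (of_int (a * snd (quotient_of q)) :: rat)"
    using assms(2) by (simp add: field_simps)
  then show ?thesis by (simp only: of_int_eq_iff)
qed

interpretation qvs: vector_space "rat_scale :: rat \<Rightarrow> 'm::ab_group_add qtensor \<Rightarrow> 'm qtensor"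
proof
  fix q r :: rat and x y :: "'m qtensor"
  define a b c d where "a = fst (quotient_of q)" and "b = snd (quotient_of q)"
    and "c = fst (quotient_of r)" and "d = snd (quotient_of r)"
  have q: "q = of_int a / of_int b" and r: "r = of_int c / of_int d" and bd: "b \<noteq> 0" "d \<noteq> 0"
    using quotient_of_denom_pos'[of q] quotient_of_denom_pos'[of r]
    by (simp_all add: a_def b_def c_def d_def quotient_of_div)
  show "q \<cdot>\<^sub>Q (x + y) = q \<cdot>\<^sub>Q x + q \<cdot>\<^sub>Q y"
    using bd unfolding b_def
    by transfer (auto elim!: qtensor_relE intro!: qtensor_relI[of _ _ 1]
      simp: int_mod.scale_right_distrib mult_ac)
  define e f where "e = fst (quotient_of (q + r))" and "f = snd (quotient_of (q + r))"
  have f: "f \<noteq> 0" using quotient_of_denom_pos'[of "q + r"] by (simp add: f_def)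
  have efk: "e * (b * d) = (a * d + c * b) * f"
    unfolding e_def f_def by (rule rat_eq_cross) (use q r bd in \<open>auto simp: field_simps\<close>)
  have e: "(e * b * d * k) \<cdot>\<^sub>Z u = (a * d * f * k) \<cdot>\<^sub>Z u + (c * b * f * k) \<cdot>\<^sub>Z u" for k and u :: 'm
  proof -
    have "e * b * d * k = e * (b * d) * k" by (simp only: mult.assoc)
    also have "\<dots> = a * d * f * k + c * b * f * k" by (simp only: efk distrib_right)
    finally show ?thesis by (simp only: int_mod.scale_left_distrib)
  qed
  show "(q + r) \<cdot>\<^sub>Q x = q \<cdot>\<^sub>Q x + r \<cdot>\<^sub>Q x"
  proof (transfer fixing: q r, unfold split_paired_all, clarsimp)
    fix u :: 'm and n :: int
    assume "qtensor_rel (u, n) (u, n)"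
    then have n: "n \<noteq> 0" by (rule qtensor_relE)
    have "qtensor_rel (e \<cdot>\<^sub>Z u, f * n) ((d * n * a) \<cdot>\<^sub>Z u + (b * n * c) \<cdot>\<^sub>Z u, b * n * (d * n))"
      using n f bd e[of "n * n"]
      by (intro qtensor_relI[of _ _ 1]) (auto simp: int_mod.scale_right_distrib mult_ac)
    then show "qtensor_rel (fst (quotient_of (q + r)) \<cdot>\<^sub>Z u, snd (quotient_of (q + r)) * n)
       ((snd (quotient_of r) * n * fst (quotient_of q)) \<cdot>\<^sub>Z u +
        (snd (quotient_of q) * n * fst (quotient_of r)) \<cdot>\<^sub>Z u,
        snd (quotient_of q) * n * (snd (quotient_of r) * n))"
      by (simp add: a_def b_def c_def d_def e_def f_def)
  qed
  define g h where "g = fst (quotient_of (q * r))" and "h = snd (quotient_of (q * r))"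
  have h: "h \<noteq> 0" using quotient_of_denom_pos'[of "q * r"] by (simp add: h_def)
  have "g * (b * d) = (a * c) * h"
    unfolding g_def h_def by (rule rat_eq_cross) (use q r bd in auto)
  then have g: "(a * c * h * k) \<cdot>\<^sub>Z u = (g * b * d * k) \<cdot>\<^sub>Z u" for k and u :: 'm
    by (metis mult.assoc)
  show "q \<cdot>\<^sub>Q (r \<cdot>\<^sub>Q x) = (q * r) \<cdot>\<^sub>Q x"
  proof (transfer fixing: q r, unfold split_paired_all, clarsimp)
    fix u :: 'm and n :: int
    assume "qtensor_rel (u, n) (u, n)"
    then have n: "n \<noteq> 0" by (rule qtensor_relE)
    have "qtensor_rel ((a * c) \<cdot>\<^sub>Z u, b * (d * n)) (g \<cdot>\<^sub>Z u, h * n)"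
      using n h bd g[of n u] by (intro qtensor_relI[of _ _ 1]) (auto simp: mult_ac)
    then show "qtensor_rel ((fst (quotient_of q) * fst (quotient_of r)) \<cdot>\<^sub>Z u,
        snd (quotient_of q) * (snd (quotient_of r) * n))
       (fst (quotient_of (q * r)) \<cdot>\<^sub>Z u, snd (quotient_of (q * r)) * n)"
      by (simp add: a_def b_def c_def d_def g_def h_def)
  qed
  show "1 \<cdot>\<^sub>Q x = x"
    by transfer (auto elim!: qtensor_relE intro!: qtensor_relI[of _ _ 1])
qed

text \<open>The canonical map \<open>M \<rightarrow> \<rat> \<otimes> M\<close>, \<open>u \<mapsto> 1 \<otimes> u\<close>.\<close>

lift_definition to_qtensor :: "'m::ab_group_add \<Rightarrow> 'm qtensor" is "\<lambda>u. (u, 1)"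
  by (rule qtensor_relI[of _ _ 1]) auto


section \<open>Cones\<close>

definition convex_cone_Q :: "'m::ab_group_add qtensor set \<Rightarrow> bool"
  where "convex_cone_Q C \<longleftrightarrow>
    0 \<in> C \<and> (\<forall>x\<in>C. \<forall>y\<in>C. x + y \<in> C) \<and> (\<forall>x\<in>C. \<forall>q\<ge>0. q \<cdot>\<^sub>Q x \<in> C)"

text \<open>
  Relative interior of a cone: the interior of \<open>C\<close> in its linear span (which is its affine hull
  because \<open>0 \<in> C\<close>), for the standard topology of a finite-dimensional rational vector space.
  Basic neighbourhoods of \<open>0\<close> are the coordinate boxes \<open>{\<Sum>b\<in>B. c b \<cdot>\<^sub>Q b | \<forall>b\<in>B. \<bar>c b\<bar> < \<epsilon>}\<close> with
  respect to a basis \<open>B\<close>; any two bases define the same topology.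
\<close>

definition rel_interior_Q :: "'m::ab_group_add qtensor set \<Rightarrow> 'm qtensor set"
  where "rel_interior_Q C = {x \<in> C. \<exists>B \<epsilon>. finite B \<and> qvs.independent B \<and> qvs.span B = UNIV \<and> 0 < \<epsilon> \<and>
    (\<forall>c. (\<forall>b\<in>B. \<bar>c b\<bar> < \<epsilon>) \<and> x + (\<Sum>b\<in>B. c b \<cdot>\<^sub>Q b) \<in> qvs.span C \<longrightarrow>
         x + (\<Sum>b\<in>B. c b \<cdot>\<^sub>Q b) \<in> C)}"


section \<open>Graded algebras\<close>

locale algebra_over_field = vector_space scale
  for scale :: "'k::field \<Rightarrow> 'a::comm_ring_1 \<Rightarrow> 'a" +
  assumes scale_mult_left: "scale c (x * y) = scale c x * y"

definition subalgebra :: "('k::field \<Rightarrow> 'a::comm_ring_1 \<Rightarrow> 'a) \<Rightarrow> 'a set \<Rightarrow> bool"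
  where "subalgebra scale S \<longleftrightarrow>
    module.subspace scale S \<and> 1 \<in> S \<and> (\<forall>x\<in>S. \<forall>y\<in>S. x * y \<in> S)"

definition finitely_generated_algebra :: "('k::field \<Rightarrow> 'a::comm_ring_1 \<Rightarrow> 'a) \<Rightarrow> bool"
  where "finitely_generated_algebra scale \<longleftrightarrow>
    (\<exists>G. finite G \<and> subalgebra scale hull G = UNIV)"

locale graded_algebra = algebra_over_field scale
  for scale :: "'k::field \<Rightarrow> 'a::comm_ring_1 \<Rightarrow> 'a" and A :: "'m::ab_group_add \<Rightarrow> 'a set" +
  assumes subspace_component: "subspace (A u)"
    and direct_sum: "\<exists>!c. finite {u. c u \<noteq> 0} \<and> (\<forall>u. c u \<in> A u) \<and> f = (\<Sum>u | c u \<noteq> 0. c u)"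
    and mult_component: "f \<in> A u \<Longrightarrow> g \<in> A v \<Longrightarrow> f * g \<in> A (u + v)"

definition weight_cone :: "('m::ab_group_add \<Rightarrow> 'a::comm_ring_1 set) \<Rightarrow> 'm qtensor set"
  where "weight_cone A = convex_cone_Q hull {to_qtensor u | u. A u \<noteq> {0}}"

text \<open>
  The elements of \<open>U \<otimes> V\<close> are the finite sums \<open>\<Sum>i<n. f i \<otimes> g i\<close>, so the following says that
  \<open>U \<otimes> V \<rightarrow> W\<close>, \<open>f \<otimes> g \<mapsto> f * g\<close>, is surjective.
\<close>

definition mult_map_surj :: "'a::comm_ring_1 set \<Rightarrow> 'a set \<Rightarrow> 'a set \<Rightarrow> bool"
  where "mult_map_surj U V W \<longleftrightarrow>
    (\<forall>h\<in>W. \<exists>(n::nat) f g. (\<forall>i<n. f i \<in> U \<and> g i \<in> V) \<and> h = (\<Sum>i<n. f i * g i))"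

definition generating_pair :: "('m::ab_group_add \<Rightarrow> 'a::comm_ring_1 set) \<Rightarrow> 'm \<Rightarrow> 'm \<Rightarrow> bool"
  where "generating_pair A u v \<longleftrightarrow>
    to_qtensor u \<in> weight_cone A \<and> to_qtensor v \<in> weight_cone A \<and>
    (\<exists>m>0. \<forall>k>0. mult_map_surj (A ((k * m) \<cdot>\<^sub>Z u)) (A ((k * m) \<cdot>\<^sub>Z v)) (A ((k * m) \<cdot>\<^sub>Z (u + v))))"


section \<open>Orbit cones and the GIT-fan\<close>

definition ring_ideal :: "'a::comm_ring_1 set \<Rightarrow> bool"
  where "ring_ideal I \<longleftrightarrow> module.subspace (*) I"

text \<open>The closed points of \<open>Spec A\<close> are the maximal ideals of \<open>A\<close>.\<close>

definition closed_points :: "'a::comm_ring_1 set set"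
  where "closed_points =
    {x. ring_ideal x \<and> x \<noteq> UNIV \<and> (\<forall>J. ring_ideal J \<and> x \<subseteq> J \<longrightarrow> J = x \<or> J = UNIV)}"

text \<open>The value \<open>f(x)\<close> is the residue class of \<open>f\<close> modulo \<open>x\<close>, so \<open>f(x) \<noteq> 0\<close> means \<open>f \<notin> x\<close>.\<close>

definition orbit_cone :: "('m::ab_group_add \<Rightarrow> 'a::comm_ring_1 set) \<Rightarrow> 'a set \<Rightarrow> 'm qtensor set"
  where "orbit_cone A x = convex_cone_Q hull
    {to_qtensor u | u. to_qtensor u \<in> weight_cone A \<and> (\<exists>f\<in>A u. f \<notin> x)}"

definition GIT_cone :: "('m::ab_group_add \<Rightarrow> 'a::comm_ring_1 set) \<Rightarrow> 'm qtensor \<Rightarrow> 'm qtensor set"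
  where "GIT_cone A u = (\<Inter>x \<in> {x \<in> closed_points. u \<in> orbit_cone A x}. orbit_cone A x)"

definition GIT_fan :: "('m::ab_group_add \<Rightarrow> 'a::comm_ring_1 set) \<Rightarrow> 'm qtensor set set"
  where "GIT_fan A = GIT_cone A ` weight_cone A"

end

theory Submission
  imports Defs
begin

text \<open>
  For a generating pair, a homogeneous function of degree in \<open>\<nat>(u + v)\<close> not vanishing at \<open>x\<close> has a power
  that is a sum of products of elements of degrees in \<open>\<nat>u\<close> and \<open>\<nat>v\<close>, so \<open>u\<close> and \<open>v\<close> lie in every orbit cone
  containing \<open>u + v\<close>, that is, in \<open>\<lambda>(u + v)\<close>.

  Conversely, let \<open>p, q \<in> \<lambda>(w)\<close>. Every orbit cone containing \<open>p + q\<close> contains \<open>p\<close>: this replaces the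
  fan property, and rests on the surjectivity of the morphism of quotients from the
  \<open>w\<close>-semistable to the \<open>(p + q)\<close>-semistable points. Applied to \<open>u + v\<close> and to
  \<open>k u = v + (k u - v)\<close>, where \<open>k u - v \<in> \<lambda>(w)\<close> because \<open>u\<close> is in the relative interior, it shows that
  \<open>(u + v)\<close>-semistable points are \<open>u\<close>-semistable and \<open>u\<close>-semistable points are \<open>v\<close>-semistable. A
  homogeneous Nullstellensatz turns these inclusions into factorizations of the components
  \<open>A (k u)\<close> and \<open>A (k (u + v))\<close> for large \<open>k\<close>, which combine to surjectivity of multiplication.
\<close>


section \<open>Lattices and rational cones\<close>

text \<open>Coordinates are additive, so this reduces to torsion-freeness of the integers. The
  lattice hypothesis enters the later arguments in this form.\<close>

lemma lattice_torsion_free: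
  fixes u :: "'m::ab_group_add"
  assumes "is_lattice TYPE('m)" and "n \<cdot>\<^sub>Z u = 0" and "n \<noteq> 0"
  shows "u = 0"
proof -
  obtain d and \<phi> :: "'m \<Rightarrow> nat \<Rightarrow> int"
    where \<phi>: "bij_betw \<phi> UNIV {c. \<forall>i\<ge>d. c i = 0}" and add: "\<And>u v i. \<phi> (u + v) i = \<phi> u i + \<phi> v i"
    using assms(1) unfolding is_lattice_def by blast
  have zero: "\<phi> 0 i = 0" for i using add[of 0 0 i] by simp
  have sum: "\<phi> (\<Sum>i<k. u) i = int k * \<phi> u i" for k :: nat and i
    by (induction k) (simp_all add: zero add algebra_simps)
  have "(\<Sum>i<nat \<bar>n\<bar>. u) = 0"
    using assms(2) by (auto simp: int_scale_def abs_if split: if_splits)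
  then have "\<phi> u i = \<phi> 0 i" for i
    using sum[where k = "nat \<bar>n\<bar>" and i = i] assms(3) by (simp add: zero)
  then have "\<phi> u = \<phi> 0" by (rule ext)
  then show ?thesis using bij_betw_imp_inj_on[OF \<phi>] by (simp add: inj_eq)
qed

lemma to_qtensor_eq_iff: "to_qtensor u = to_qtensor v \<longleftrightarrow> (\<exists>k. k \<noteq> 0 \<and> k \<cdot>\<^sub>Z u = k \<cdot>\<^sub>Z v)"
  by transfer (simp add: qtensor_rel_def)

lemma to_qtensor_zero: "to_qtensor 0 = 0"
  by transfer (rule qtensor_relI[of _ _ 1], auto)

lemma to_qtensor_add: "to_qtensor (u + v) = to_qtensor u + to_qtensor v"
  by transfer (auto intro: qtensor_relI[of _ _ 1])

lemma to_qtensor_minus: "to_qtensor (- u) = - to_qtensor u"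
  by transfer (auto intro: qtensor_relI[of _ _ 1])

lemma to_qtensor_diff: "to_qtensor (u - v) = to_qtensor u - to_qtensor v"
  using to_qtensor_add[of u "- v"] by (simp add: to_qtensor_minus)

lemma to_qtensor_scale: "to_qtensor (n \<cdot>\<^sub>Z u) = of_int n \<cdot>\<^sub>Q to_qtensor u"
  by transfer (auto intro: qtensor_relI[of _ _ 1])

section \<open>Rational convex cones\<close>

lemma convex_cone_Q_hull: "convex_cone_Q (convex_cone_Q hull S)"
  by (rule hull_in) (auto simp: convex_cone_Q_def)

lemma convex_cone_Q_scale_iff:
  assumes "convex_cone_Q C" and "q > 0"
  shows "q \<cdot>\<^sub>Q z \<in> C \<longleftrightarrow> z \<in> C"
proof
  assume "q \<cdot>\<^sub>Q z \<in> C"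
  moreover have "0 \<le> inverse q" using assms(2) by simp
  ultimately have "inverse q \<cdot>\<^sub>Q q \<cdot>\<^sub>Q z \<in> C"
    using assms(1) unfolding convex_cone_Q_def by blast
  then show "z \<in> C" using assms(2) by simp
qed (use assms in \<open>auto simp: convex_cone_Q_def\<close>)

text \<open>For a submonoid \<open>W\<close>, the points with a positive integral multiple in the
  image of \<open>W\<close> already form a convex cone, since denominators can be cleared.\<close>

lemma convex_cone_Q_hull_to_qtensor:
  assumes zero: "0 \<in> W" and add: "\<And>u v. u \<in> W \<Longrightarrow> v \<in> W \<Longrightarrow> u + v \<in> W"
  shows "z \<in> convex_cone_Q hull (to_qtensor ` W) \<longleftrightarrow> (\<exists>n>0. \<exists>u\<in>W. of_nat n \<cdot>\<^sub>Q z = to_qtensor u)"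
proof
  let ?C = "{z. \<exists>n>0. \<exists>u\<in>W. of_nat n \<cdot>\<^sub>Q z = to_qtensor u}"
  have mult: "int n \<cdot>\<^sub>Z u \<in> W" if "u \<in> W" for n u
    by (induction n) (use that in \<open>auto simp: int_mod.scale_left_distrib zero add\<close>)
  have "of_nat 1 \<cdot>\<^sub>Q 0 = to_qtensor 0" by (simp add: to_qtensor_zero)
  then have "0 \<in> ?C" using zero by blast
  moreover have "y + z \<in> ?C" if y: "y \<in> ?C" and z: "z \<in> ?C" for y z
  proof -
    obtain m u where m: "m > 0" "u \<in> W" "of_nat m \<cdot>\<^sub>Q y = to_qtensor u"
      using y by blast
    obtain n v where n: "n > 0" "v \<in> W" "of_nat n \<cdot>\<^sub>Q z = to_qtensor v"
      using z by blast
    have "of_nat (m * n) \<cdot>\<^sub>Q (y + z) = of_nat n \<cdot>\<^sub>Q of_nat m \<cdot>\<^sub>Q y + of_nat m \<cdot>\<^sub>Q of_nat n \<cdot>\<^sub>Q z"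
      unfolding qvs.scale_right_distrib qvs.scale_scale of_nat_mult by (simp only: mult.commute)
    also have "\<dots> = to_qtensor (int n \<cdot>\<^sub>Z u + int m \<cdot>\<^sub>Z v)"
      unfolding m(3) n(3) by (simp add: to_qtensor_add to_qtensor_scale)
    finally have "of_nat (m * n) \<cdot>\<^sub>Q (y + z) = to_qtensor (int n \<cdot>\<^sub>Z u + int m \<cdot>\<^sub>Z v)" .
    moreover have "int n \<cdot>\<^sub>Z u + int m \<cdot>\<^sub>Z v \<in> W" using add mult m n by blast
    moreover have "m * n > 0" using m n by simp
    ultimately show ?thesis by blast
  qed
  moreover have "q \<cdot>\<^sub>Q z \<in> ?C" if z: "z \<in> ?C" and q0: "q \<ge> 0" for z q
  proof -
    obtain n u where n: "n > 0" "u \<in> W" "of_nat n \<cdot>\<^sub>Q z = to_qtensor u" using z by blast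
    define a b where "a = nat (fst (quotient_of q))" and "b = nat (snd (quotient_of q))"
    have den: "snd (quotient_of q) > 0" by (rule quotient_of_denom_pos')
    have quot: "q = of_int (fst (quotient_of q)) / of_int (snd (quotient_of q))"
      by (simp add: quotient_of_div)
    have b: "b > 0" using den by (simp add: b_def)
    have "fst (quotient_of q) \<ge> 0"
      using q0 den quot by (metis of_int_0_le_iff of_int_pos zero_le_divide_iff not_le)
    then have q: "q = of_nat a / of_nat b"
      using quot den unfolding a_def b_def by (simp add: of_nat_nat)
    have "of_nat (n * b) \<cdot>\<^sub>Q q \<cdot>\<^sub>Q z = of_nat a \<cdot>\<^sub>Q of_nat n \<cdot>\<^sub>Q z"
      using b by (simp add: q mult_ac)
    also have "\<dots> = to_qtensor (int a \<cdot>\<^sub>Z u)" unfolding n(3) by (simp add: to_qtensor_scale)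
    finally have "of_nat (n * b) \<cdot>\<^sub>Q q \<cdot>\<^sub>Q z = to_qtensor (int a \<cdot>\<^sub>Z u)" .
    moreover have "n * b > 0" using n b by simp
    ultimately show ?thesis using mult[OF n(2)] by blast
  qed
  ultimately have "convex_cone_Q ?C" unfolding convex_cone_Q_def by blast
  moreover have "to_qtensor ` W \<subseteq> ?C" by (force intro!: exI[of _ "1 :: nat"])
  ultimately have "convex_cone_Q hull (to_qtensor ` W) \<subseteq> ?C" by (intro hull_minimal)
  then show "\<exists>n>0. \<exists>u\<in>W. of_nat n \<cdot>\<^sub>Q z = to_qtensor u"
    if "z \<in> convex_cone_Q hull (to_qtensor ` W)"
    using that by blast
next
  assume "\<exists>n>0. \<exists>u\<in>W. of_nat n \<cdot>\<^sub>Q z = to_qtensor u"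
  then obtain n u where n: "n > 0" "u \<in> W" "of_nat n \<cdot>\<^sub>Q z = to_qtensor u" by blast
  have "of_nat n \<cdot>\<^sub>Q z \<in> convex_cone_Q hull (to_qtensor ` W)" unfolding n(3)
    using n(2) by (intro hull_inc imageI)
  then show "z \<in> convex_cone_Q hull (to_qtensor ` W)"
    using n(1) by (simp only: convex_cone_Q_scale_iff[OF convex_cone_Q_hull] of_nat_0_less_iff)
qed

text \<open>A small step from \<open>u\<close> towards \<open>- v\<close> stays in the span of
  \<open>C\<close>, hence in \<open>C\<close>; then rescale.\<close>

lemma rel_interior_Q_absorbs:
  assumes C: "convex_cone_Q C" and u: "u \<in> rel_interior_Q C" and v: "v \<in> C"
  obtains k :: nat where "k > 0" and "of_nat k \<cdot>\<^sub>Q u - v \<in> C"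
proof -
  obtain B \<epsilon> where B: "finite B" "qvs.span B = UNIV" and \<epsilon>: "0 < \<epsilon>"
    and nbhd: "\<And>c. (\<forall>b\<in>B. \<bar>c b\<bar> < \<epsilon>) \<Longrightarrow> u + (\<Sum>b\<in>B. c b \<cdot>\<^sub>Q b) \<in> qvs.span C
         \<Longrightarrow> u + (\<Sum>b\<in>B. c b \<cdot>\<^sub>Q b) \<in> C" and uC: "u \<in> C"
    using u unfolding rel_interior_Q_def by blast
  obtain r where r: "v = (\<Sum>b\<in>B. r b \<cdot>\<^sub>Q b)"
    using B qvs.span_finite[OF B(1)] by auto
  obtain k0 :: nat where "(\<Sum>b\<in>B. \<bar>r b\<bar>) / \<epsilon> < of_nat k0"
    using reals_Archimedean2 by blast
  then obtain k :: nat where k: "(\<Sum>b\<in>B. \<bar>r b\<bar>) / \<epsilon> < of_nat k" "k > 0"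
    by (intro that[of "Suc k0"]) (auto intro: less_trans)
  \<comment> \<open>Coordinates of \<open>v\<close> divided by \<open>- k\<close>; \<open>k\<close>
    was chosen to make them smaller than \<open>\<epsilon>\<close>.\<close>
  define c where "c b = - (r b / of_nat k)" for b
  have "\<bar>c b\<bar> < \<epsilon>" if "b \<in> B" for b
  proof -
    have "\<bar>r b\<bar> \<le> (\<Sum>b\<in>B. \<bar>r b\<bar>)" by (rule member_le_sum) (use B that in auto)
    also have "\<dots> < \<epsilon> * of_nat k" using k \<epsilon> by (simp add: field_simps)
    finally show ?thesis using k by (simp add: c_def field_simps)
  qed
  moreover have sum: "(\<Sum>b\<in>B. c b \<cdot>\<^sub>Q b) = - ((1 / of_nat k) \<cdot>\<^sub>Q v)"
    by (simp add: c_def r qvs.scale_sum_right sum_negf)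
  moreover have "u - (1 / of_nat k) \<cdot>\<^sub>Q v \<in> qvs.span C"
    using uC v by (intro qvs.span_diff qvs.span_scale qvs.span_base)
  ultimately have "u - (1 / of_nat k) \<cdot>\<^sub>Q v \<in> C" using nbhd[of c] by auto
  then have "of_nat k \<cdot>\<^sub>Q (u - (1 / of_nat k) \<cdot>\<^sub>Q v) \<in> C"
    using C by (auto simp: convex_cone_Q_def)
  then show thesis using k that[of k] by (simp add: qvs.scale_right_diff_distrib)
qed


section \<open>Dickson's lemma\<close>

text \<open>Induction on the index set, for all \<open>S\<close> at once: drop the coordinate
  \<open>j\<close> and treat the finitely many slices with small \<open>j\<close>-th coordinate
  separately.\<close>

lemma Dickson:
  fixes S :: "('i \<Rightarrow> nat) set"
  assumes "finite I"
  obtains F where "finite F" and "F \<subseteq> S" and "\<And>s. s \<in> S \<Longrightarrow> \<exists>t\<in>F. \<forall>i\<in>I. t i \<le> s i"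
proof -
  have "\<exists>F. finite F \<and> F \<subseteq> S \<and> (\<forall>s\<in>S. \<exists>t\<in>F. \<forall>i\<in>I. t i \<le> s i)"
    using assms
  proof (induction I arbitrary: S)
    case empty
    show ?case
    proof (cases "S = {}")
      case False
      then obtain s where "s \<in> S" by auto
      then show ?thesis by (intro exI[of _ "{s}"]) auto
    qed auto
  next
    case (insert j I)
    obtain F where F: "finite F" "F \<subseteq> S" "\<And>s. s \<in> S \<Longrightarrow> \<exists>t\<in>F. \<forall>i\<in>I. t i \<le> s i"
      using insert.IH[of S] by auto
    have "\<forall>c. \<exists>F. finite F \<and> F \<subseteq> {s\<in>S. s j = c} \<and>
        (\<forall>s\<in>{s\<in>S. s j = c}. \<exists>t\<in>F. \<forall>i\<in>I. t i \<le> s i)"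
      using insert.IH by blast
    then obtain F' where "\<forall>c. finite (F' c) \<and> F' c \<subseteq> {s\<in>S. s j = c} \<and>
        (\<forall>s\<in>{s\<in>S. s j = c}. \<exists>t\<in>F' c. \<forall>i\<in>I. t i \<le> s i)"
      by (rule choice[THEN exE])
    then have F': "finite (F' c)" "F' c \<subseteq> {s\<in>S. s j = c}"
      "\<And>s. s \<in> S \<Longrightarrow> s j = c \<Longrightarrow> \<exists>t\<in>F' c. \<forall>i\<in>I. t i \<le> s i" for c
      by auto
    \<comment> \<open>If \<open>s j\<close> is at least \<open>K\<close>, an element of
      \<open>F\<close> below \<open>s\<close> on \<open>I\<close> is also below it at
      \<open>j\<close>; otherwise \<open>F' (s j)\<close> serves.\<close>
    define K where "K = (\<Sum>t\<in>F. t j)"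
    have K: "t j \<le> K" if "t \<in> F" for t
      unfolding K_def by (rule member_le_sum) (use F that in auto)
    have "\<exists>t\<in>F \<union> (\<Union>c<K. F' c). \<forall>i\<in>insert j I. t i \<le> s i" if s: "s \<in> S" for s
    proof (cases "s j < K")
      case True
      obtain t where t: "t \<in> F' (s j)" "\<forall>i\<in>I. t i \<le> s i" using F'(3)[OF s refl] by blast
      then have "t j = s j" using F'(2) by blast
      then show ?thesis using t True by (intro bexI[of _ t]) auto
    next
      case False
      then show ?thesis using F(3)[OF s] K by (metis UnI1 insertE le_trans linorder_not_le)
    qed
    moreover have "F \<union> (\<Union>c<K. F' c) \<subseteq> S" using F(2) F'(2) by blast
    moreover have "finite (F \<union> (\<Union>c<K. F' c))" using F(1) F'(1) by simp
    ultimately show ?case by (intro exI[of _ "F \<union> (\<Union>c<K. F' c)"] conjI ballI)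
  qed
  then show thesis using that by blast
qed


section \<open>Ideals and products of sets\<close>

lemma ring_ideal_iff:
  "ring_ideal (I :: 'a::comm_ring_1 set) \<longleftrightarrow>
    0 \<in> I \<and> (\<forall>f\<in>I. \<forall>g\<in>I. f + g \<in> I) \<and> (\<forall>c. \<forall>f\<in>I. c * f \<in> I)"
proof -
  have "module ((*) :: 'a \<Rightarrow> 'a \<Rightarrow> 'a)" by unfold_locales (auto simp: algebra_simps)
  then show ?thesis by (simp add: ring_ideal_def module.subspace_def)
qed

lemma ring_ideal_diff: "ring_ideal I \<Longrightarrow> f \<in> I \<Longrightarrow> g \<in> I \<Longrightarrow> f - g \<in> I"
  unfolding ring_ideal_iff by (metis diff_conv_add_uminus mult_minus1)

lemma ring_ideal_power:
  assumes "ring_ideal I" and "f ^ c \<in> I" and "c \<le> d"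
  shows "f ^ d \<in> I"
  using assms by (metis le_add_diff_inverse2 power_add ring_ideal_iff)

text \<open>Finite sums of products: the image of the multiplication map on subspaces, and for
  \<open>U = UNIV\<close> the ideal generated by \<open>V\<close>. Ideals and degreewise
  factorizations thus share one calculus.\<close>

inductive_set sum_prods :: "'a::comm_ring_1 set \<Rightarrow> 'a set \<Rightarrow> 'a set" (infixl "\<odot>" 70)
  for U V where
  zero: "0 \<in> U \<odot> V"
| step: "f \<in> U \<Longrightarrow> g \<in> V \<Longrightarrow> h \<in> U \<odot> V \<Longrightarrow> f * g + h \<in> U \<odot> V"

lemma sum_prods_mult: "f \<in> U \<Longrightarrow> g \<in> V \<Longrightarrow> f * g \<in> U \<odot> V"
  using sum_prods.step[OF _ _ sum_prods.zero] by fastforce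

lemma sum_prods_add: "f \<in> U \<odot> V \<Longrightarrow> g \<in> U \<odot> V \<Longrightarrow> f + g \<in> U \<odot> V"
  by (induction rule: sum_prods.induct) (auto simp: add.assoc intro: sum_prods.step)

lemma sum_prods_subsetI:
  assumes "0 \<in> W" and "\<And>f g. f \<in> W \<Longrightarrow> g \<in> W \<Longrightarrow> f + g \<in> W"
    and "\<And>f g. f \<in> U \<Longrightarrow> g \<in> V \<Longrightarrow> f * g \<in> W"
  shows "U \<odot> V \<subseteq> W"
proof
  fix h assume "h \<in> U \<odot> V"
  then show "h \<in> W" by induction (use assms in auto)
qed

lemma sum_prods_mono: "U \<subseteq> U' \<Longrightarrow> V \<subseteq> V' \<Longrightarrow> U \<odot> V \<subseteq> U' \<odot> V'"
  by (rule sum_prods_subsetI) (auto intro: sum_prods.zero sum_prods_add sum_prods_mult)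

lemma sum_prods_commute_subset: "U \<odot> V \<subseteq> V \<odot> U"
proof (rule sum_prods_subsetI)
  show "f * g \<in> V \<odot> U" if "f \<in> U" "g \<in> V" for f g
    using sum_prods_mult[OF that(2,1)] by (simp add: mult.commute)
qed (auto intro: sum_prods.zero sum_prods_add)

lemma sum_prods_commute: "U \<odot> V = V \<odot> U"
  using sum_prods_commute_subset by blast

lemma sum_prods_assoc_subset: "(U \<odot> V) \<odot> W \<subseteq> U \<odot> (V \<odot> W)"
proof (rule sum_prods_subsetI)
  fix f g assume "f \<in> U \<odot> V" and g: "g \<in> W"
  then show "f * g \<in> U \<odot> (V \<odot> W)"
    by induction (auto simp: distrib_right mult.assoc
        intro: sum_prods.zero intro!: sum_prods.step sum_prods_mult)
qed (auto intro: sum_prods.zero sum_prods_add)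

lemma sum_prods_assoc: "(U \<odot> V) \<odot> W = U \<odot> (V \<odot> W)"
  using sum_prods_assoc_subset[of U V W] sum_prods_assoc_subset[of W V U]
  by (metis subset_antisym sum_prods_commute)

lemma sum_prods_left_commute: "U \<odot> (V \<odot> W) = V \<odot> (U \<odot> W)"
  by (metis sum_prods_assoc sum_prods_commute)

lemma mult_map_surj_iff: "mult_map_surj U V W \<longleftrightarrow> W \<subseteq> U \<odot> V"
proof -
  have "(\<exists>(n::nat) f g. (\<forall>i<n. f i \<in> U \<and> g i \<in> V) \<and> h = (\<Sum>i<n. f i * g i)) \<longleftrightarrow> h \<in> U \<odot> V" for h
  proof
    assume "\<exists>(n::nat) f g. (\<forall>i<n. f i \<in> U \<and> g i \<in> V) \<and> h = (\<Sum>i<n. f i * g i)"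
    then obtain n :: nat and f g where fg: "\<forall>i<n. f i \<in> U \<and> g i \<in> V" "h = (\<Sum>i<n. f i * g i)" by blast
    have "(\<Sum>i<k. f i * g i) \<in> U \<odot> V" if "k \<le> n" for k
      using that fg(1) by (induction k) (auto intro!: sum_prods_add sum_prods_mult intro: sum_prods.zero)
    then show "h \<in> U \<odot> V" using fg by auto
  next
    assume "h \<in> U \<odot> V"
    then show "\<exists>(n::nat) f g. (\<forall>i<n. f i \<in> U \<and> g i \<in> V) \<and> h = (\<Sum>i<n. f i * g i)"
    proof induction
      case zero
      show ?case by (intro exI[of _ 0]) auto
    next
      case (step a b h)
      then obtain n :: nat and f g where fg: "\<forall>i<n. f i \<in> U \<and> g i \<in> V" "h = (\<Sum>i<n. f i * g i)"
        by blast
      have "(\<Sum>i<Suc n. (f(n := a)) i * (g(n := b)) i) = a * b + h"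
        by (simp add: fg(2) add.commute)
      moreover have "\<forall>i<Suc n. (f(n := a)) i \<in> U \<and> (g(n := b)) i \<in> V"
        using fg(1) step.hyps by (auto simp: less_Suc_eq)
      ultimately show ?case by metis
    qed
  qed
  then show ?thesis unfolding mult_map_surj_def by blast
qed

lemma ring_ideal_UNIV_sum_prods: "ring_ideal (UNIV \<odot> S)"
proof -
  have "c * f \<in> UNIV \<odot> S" if "f \<in> UNIV \<odot> S" for c f
    using that by induction
      (auto simp: distrib_left mult.assoc[symmetric] intro: sum_prods.zero sum_prods.step)
  then show ?thesis unfolding ring_ideal_iff by (auto intro: sum_prods.zero sum_prods_add)
qed

lemma UNIV_sum_prods_inc: "S \<subseteq> UNIV \<odot> S"
  using sum_prods_mult[of 1 UNIV] by fastforce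

section \<open>Maximal ideals as closed points\<close>

lemma ring_ideal_eq_UNIV: "ring_ideal I \<Longrightarrow> 1 \<in> I \<Longrightarrow> I = UNIV"
  unfolding ring_ideal_iff by (metis UNIV_eq_I mult.right_neutral)

lemma ring_ideal_add_multiples:
  assumes "ring_ideal I"
  shows "ring_ideal {i + b * f | i b. i \<in> I}"
proof -
  have "\<exists>i b. 0 = i + b * f \<and> i \<in> I"
    by (rule exI[of _ 0], rule exI[of _ 0]) (use assms in \<open>auto simp: ring_ideal_iff\<close>)
  moreover have "\<exists>i'' b''. i + b * f + (i' + b' * f) = i'' + b'' * f \<and> i'' \<in> I"
    if "i \<in> I" "i' \<in> I" for i i' b b'
    by (rule exI[of _ "i + i'"], rule exI[of _ "b + b'"])
      (use assms that in \<open>auto simp: ring_ideal_iff algebra_simps\<close>)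
  moreover have "\<exists>i' b'. c * (i + b * f) = i' + b' * f \<and> i' \<in> I" if "i \<in> I" for c i b
    by (rule exI[of _ "c * i"], rule exI[of _ "c * b"])
      (use assms that in \<open>auto simp: ring_ideal_iff algebra_simps\<close>)
  ultimately show ?thesis unfolding ring_ideal_iff by blast
qed

text \<open>Krull's theorem by Zorn's lemma: properness means avoiding 1, which unions of chains
  preserve.\<close>

lemma exists_closed_point:
  assumes I: "ring_ideal (I :: 'a::comm_ring_1 set)" and "1 \<notin> I"
  obtains x where "x \<in> closed_points" and "I \<subseteq> x"
proof -
  define P where "P = {J. ring_ideal J \<and> 1 \<notin> J \<and> I \<subseteq> J}"
  have "\<exists>M\<in>P. \<forall>X\<in>P. M \<subseteq> X \<longrightarrow> X = M"
  proof (rule subset_Zorn_nonempty)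
    show "P \<noteq> {}" using assms by (auto simp: P_def)
    fix \<C> assume \<C>: "\<C> \<noteq> {}" "subset.chain P \<C>"
    have sum: "f + g \<in> \<Union>\<C>" if "f \<in> J" "J \<in> \<C>" "g \<in> J'" "J' \<in> \<C>" for f g J J'
    proof -
      have "J \<subseteq> J' \<or> J' \<subseteq> J" "J \<in> P" "J' \<in> P"
        using \<C>(2) that by (auto simp: subset.chain_def)
      then show ?thesis using that unfolding P_def ring_ideal_iff by blast
    qed
    have "J \<in> P" if "J \<in> \<C>" for J using \<C>(2) that by (auto simp: subset.chain_def)
    then have sub: "\<C> \<subseteq> P" by blast
    have "0 \<in> \<Union>\<C>" "I \<subseteq> \<Union>\<C>" "1 \<notin> \<Union>\<C>"
      using sub \<C>(1) unfolding P_def ring_ideal_iff by blast+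
    moreover have "c * f \<in> \<Union>\<C>" if "f \<in> \<Union>\<C>" for c f
      using sub that unfolding P_def ring_ideal_iff by blast
    moreover have "\<forall>f\<in>\<Union>\<C>. \<forall>g\<in>\<Union>\<C>. f + g \<in> \<Union>\<C>" using sum by (meson UnionE)
    ultimately show "\<Union>\<C> \<in> P" unfolding P_def ring_ideal_iff mem_Collect_eq by (intro conjI) blast+
  qed
  then obtain x where x: "x \<in> P" "\<And>X. X \<in> P \<Longrightarrow> x \<subseteq> X \<Longrightarrow> X = x" by blast
  have "x \<in> closed_points"
    using x unfolding P_def closed_points_def
    by (auto dest: ring_ideal_eq_UNIV)
  then show thesis using x that by (auto simp: P_def)
qed

lemma closed_point_ideal: "x \<in> closed_points \<Longrightarrow> ring_ideal x"
  by (simp add: closed_points_def)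

lemma closed_point_one: "x \<in> closed_points \<Longrightarrow> 1 \<notin> x"
  using ring_ideal_eq_UNIV by (auto simp: closed_points_def)

text \<open>By maximality \<open>x\<close> and \<open>f\<close> generate the unit ideal; multiplying
  \<open>1 = i + b * f\<close> by \<open>g\<close> puts \<open>g\<close> into
  \<open>x\<close>.\<close>

lemma closed_point_prime:
  assumes x: "x \<in> closed_points" and "f * g \<in> x" and "f \<notin> x"
  shows "g \<in> x"
proof -
  let ?J = "{i + b * f | i b. i \<in> x}"
  have id: "ring_ideal x" using x by (rule closed_point_ideal)
  have "x \<subseteq> ?J"
  proof
    fix i assume "i \<in> x"
    then have "i = i + 0 * f \<and> i \<in> x" by simp
    then show "i \<in> ?J" by blast
  qed
  moreover have "f \<in> ?J"
  proof -
    have "f = 0 + 1 * f \<and> 0 \<in> x" using id by (simp add: ring_ideal_iff)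
    then show ?thesis by blast
  qed
  ultimately have "?J = UNIV"
    using x ring_ideal_add_multiples[OF id, of f] assms(3) unfolding closed_points_def by blast
  then obtain i b where ib: "1 = i + b * f" "i \<in> x" by blast
  have "g = g * i + b * (f * g)" using arg_cong[OF ib(1), of "\<lambda>t. g * t"] by (simp add: algebra_simps)
  then show ?thesis using id ib(2) assms(2) unfolding ring_ideal_iff by metis
qed

lemma closed_point_power_notin: "x \<in> closed_points \<Longrightarrow> f \<notin> x \<Longrightarrow> f ^ n \<notin> x"
  by (induction n) (auto simp: closed_point_one dest: closed_point_prime)

text \<open>Gaussian elimination in place of Nakayama's lemma: modulo \<open>x\<close> the system is diagonal.\<close>

lemma linear_system_trivial:
  fixes e :: "'i \<Rightarrow> 'a::idom"
  assumes "finite E" and x: "x \<in> closed_points"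
    and "\<And>i. i \<in> E \<Longrightarrow> (\<Sum>j\<in>E. d i j * e j) = 0"
    and "\<And>i j. i \<in> E \<Longrightarrow> j \<in> E \<Longrightarrow> i \<noteq> j \<Longrightarrow> d i j \<in> x"
    and "\<And>i. i \<in> E \<Longrightarrow> d i i \<notin> x"
  shows "\<forall>i\<in>E. e i = 0"
  using assms(1,3-)
proof (induction E arbitrary: d)
  case (insert r E)
  note id = closed_point_ideal[OF x]
  \<comment> \<open>Elimination of column \<open>r\<close> by cross multiplication, without
    division. Modulo \<open>x\<close> the diagonal becomes \<open>d r r * d i i\<close>, nonzero
    because \<open>x\<close> is prime.\<close>
  define d' where "d' i j = d r r * d i j - d i r * d r j" for i j
  have row: "(\<Sum>j\<in>insert r E. d i j * e j) = d i r * e r + (\<Sum>j\<in>E. d i j * e j)" for i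
    using insert.hyps by simp
  have E: "\<forall>i\<in>E. e i = 0"
  proof (rule insert.IH)
    fix i assume i: "i \<in> E"
    have eqs: "d i r * e r + (\<Sum>j\<in>E. d i j * e j) = 0" "d r r * e r + (\<Sum>j\<in>E. d r j * e j) = 0"
      using insert.prems(1) i by (auto simp flip: row)
    have "(\<Sum>j\<in>E. d' i j * e j) = d r r * (\<Sum>j\<in>E. d i j * e j) - d i r * (\<Sum>j\<in>E. d r j * e j)"
      by (simp add: d'_def sum_distrib_left algebra_simps sum_subtractf)
    also have "\<dots> = d r r * (- (d i r * e r)) - d i r * (- (d r r * e r))"
      using eqs by (metis add.inverse_unique)
    finally show "(\<Sum>j\<in>E. d' i j * e j) = 0" by simp
    have ri: "d r i \<in> x" "d i r \<in> x" "d i i \<notin> x" "d r r \<notin> x"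
      using insert.prems(2,3) insert.hyps i by auto
    show "d' i i \<notin> x"
    proof
      assume "d' i i \<in> x"
      then have "d' i i + d i r * d r i \<in> x" using id ri unfolding ring_ideal_iff by blast
      then show False using closed_point_prime[OF x, of "d r r" "d i i"] ri by (simp add: d'_def)
    qed
    fix j assume j: "j \<in> E" "i \<noteq> j"
    have "d i j \<in> x" "d r j \<in> x" using insert.prems(2) insert.hyps i j by auto
    then show "d' i j \<in> x"
      unfolding d'_def using id by (intro ring_ideal_diff) (auto simp: ring_ideal_iff)
  qed
  have "d r r * e r = 0" using insert.prems(1)[of r] E by (simp add: row)
  moreover have "d r r \<noteq> 0" using insert.prems(3)[of r] id by (auto simp: ring_ideal_iff)
  ultimately show ?case using E by simp
qed auto


section \<open>Homogeneous components\<close>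

context graded_algebra
begin

definition component :: "'a \<Rightarrow> 'm \<Rightarrow> 'a"
  where "component f = (THE c. finite {u. c u \<noteq> 0} \<and> (\<forall>u. c u \<in> A u) \<and> f = (\<Sum>u | c u \<noteq> 0. c u))"

lemma component:
  shows finite_component: "finite {u. component f u \<noteq> 0}"
    and component_in: "component f u \<in> A u"
    and sum_component: "(\<Sum>u | component f u \<noteq> 0. component f u) = f"
proof -
  have *: "finite {u. component f u \<noteq> 0} \<and> (\<forall>u. component f u \<in> A u) \<and>
      f = (\<Sum>u | component f u \<noteq> 0. component f u)"
    unfolding component_def by (rule theI'[OF direct_sum[of f]])
  show "finite {u. component f u \<noteq> 0}" by (rule conjunct1[OF *])
  show "component f u \<in> A u" by (rule spec[OF conjunct1[OF conjunct2[OF *]]])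
  show "(\<Sum>u | component f u \<noteq> 0. component f u) = f"
    by (rule sym[OF conjunct2[OF conjunct2[OF *]]])
qed

lemma component_eqI:
  assumes "finite S" and "\<And>u. c u \<in> A u" and "\<And>u. u \<notin> S \<Longrightarrow> c u = 0" and "f = (\<Sum>u\<in>S. c u)"
  shows "component f = c"
proof -
  have sub: "{u. c u \<noteq> 0} \<subseteq> S" using assms(3) by blast
  have "f = (\<Sum>u | c u \<noteq> 0. c u)"
    unfolding assms(4) by (rule sum.mono_neutral_right) (use assms(1) sub in auto)
  then show ?thesis
    unfolding component_def using finite_subset[OF sub assms(1)] assms(2)
    by (intro the1_equality[OF direct_sum]) auto
qed

lemma A_zero: "0 \<in> A u"
  and A_add: "f \<in> A u \<Longrightarrow> g \<in> A u \<Longrightarrow> f + g \<in> A u"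
  and A_scale: "f \<in> A u \<Longrightarrow> scale c f \<in> A u"
  using subspace_component by (auto intro: subspace_0 subspace_add subspace_scale)

lemma component_homogeneous: "f \<in> A p \<Longrightarrow> component f u = (if u = p then f else 0)"
  by (rule fun_cong[OF component_eqI[of "{p}"]]) (auto simp: A_zero)

lemma sum_component_superset:
  assumes "finite S" and "{u. component f u \<noteq> 0} \<subseteq> S"
  shows "(\<Sum>u\<in>S. component f u) = f"
proof -
  have "(\<Sum>u\<in>S. component f u) = (\<Sum>u | component f u \<noteq> 0. component f u)"
    by (rule sum.mono_neutral_right) (use assms in auto)
  then show ?thesis by (simp only: sum_component)
qed

lemma component_add: "component (f + g) u = component f u + component g u"
proof (rule fun_cong[OF component_eqI])
  let ?S = "{u. component f u \<noteq> 0} \<union> {u. component g u \<noteq> 0}"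
  show "f + g = (\<Sum>u\<in>?S. component f u + component g u)"
    by (simp add: sum.distrib finite_component sum_component_superset)
qed (auto simp: finite_component component_in A_add)

lemma component_scale: "component (scale c f) u = scale c (component f u)"
proof (rule fun_cong[OF component_eqI])
  show "scale c f = (\<Sum>u | component f u \<noteq> 0. scale c (component f u))"
    by (simp add: sum_component flip: scale_sum_right)
qed (auto simp: finite_component component_in A_scale)

lemma component_zero: "component 0 u = 0"
  using component_homogeneous[OF A_zero] by auto

text \<open>Translation of degrees by \<open>q\<close> is injective, so multiplying the components
  of \<open>f\<close> by \<open>g\<close> yields the homogeneous decomposition of
  \<open>f * g\<close>.\<close>

lemma component_mult_right:
  assumes "g \<in> A q"
  shows "component (f * g) p = component f (p - q) * g"
proof (rule fun_cong[OF component_eqI])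
  let ?S = "{u. component f u \<noteq> 0}"
  have "f * g = (\<Sum>u\<in>?S. component f u) * g" by (simp add: sum_component)
  also have "\<dots> = (\<Sum>p\<in>(\<lambda>u. u + q) ` ?S. component f (p - q) * g)"
    by (subst sum.reindex) (auto simp: inj_on_def sum_distrib_right)
  finally show "f * g = (\<Sum>p\<in>(\<lambda>u. u + q) ` ?S. component f (p - q) * g)" .
  show "component f (p - q) * g \<in> A p" for p
    using mult_component[OF component_in assms, of f "p - q"] by simp
  show "component f (p - q) * g = 0" if "p \<notin> (\<lambda>u. u + q) ` ?S" for p
  proof -
    have "p = (p - q) + q" by simp
    then have "component f (p - q) = 0" using that by blast
    then show ?thesis by simp
  qed
qed (simp add: finite_component)

text \<open>The component of 1 in degree 0 fixes every homogeneous element, hence also 1, the sum of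
  its components.\<close>

lemma A_one: "1 \<in> A 0"
proof -
  have "component 1 0 * f = f" if "f \<in> A p" for f p
    using component_mult_right[OF that, of 1 p] component_homogeneous[OF that] by simp
  then have "component 1 0 * component 1 u = component 1 u" for u using component_in by blast
  then have "component 1 0 * (\<Sum>u | component 1 u \<noteq> 0. component 1 u) = 1"
    unfolding sum_distrib_left by (simp only: sum_component)
  then have "component 1 0 = 1" by (simp only: sum_component mult_1_right)
  then show ?thesis using component_in by metis
qed

lemma A_power: "f \<in> A u \<Longrightarrow> f ^ n \<in> A (int n \<cdot>\<^sub>Z u)"
  by (induction n) (auto simp: A_one int_mod.scale_left_distrib intro: mult_component)

lemma A_sum_prods: "A p \<odot> A q \<subseteq> A (p + q)"
  by (rule sum_prods_subsetI) (auto simp: A_zero A_add mult_component)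

lemma scale_mult_right: "x * scale c y = scale c (x * y)"
  by (metis mult.commute scale_mult_left)

lemma ring_ideal_scale: "ring_ideal I \<Longrightarrow> f \<in> I \<Longrightarrow> scale c f \<in> I"
  using scale_mult_left[of c 1 f] unfolding ring_ideal_iff by (metis mult_1)

text \<open>Only coefficients of degree \<open>p - q\<close> contribute in degree \<open>p\<close>.
  This turns membership in an ideal into a factorization between fixed degrees.\<close>

lemma sum_prods_component:
  assumes "f \<in> UNIV \<odot> S" and "S \<subseteq> A q"
  shows "component f p \<in> A (p - q) \<odot> S"
  using assms(1)
proof induction
  case (step a s f)
  then have "component (a * s) p = component a (p - q) * s"
    using assms(2) by (intro component_mult_right) auto
  then show ?case using step by (auto simp: component_add intro: sum_prods.step component_in)
qed (simp add: component_zero sum_prods.zero)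

lemma homogeneous_ideal_component:
  assumes "f \<in> UNIV \<odot> S" and "S \<subseteq> (\<Union>q. A q)"
  shows "component f p \<in> UNIV \<odot> S"
  using assms(1)
proof induction
  case (step a s f)
  then obtain q where "s \<in> A q" using assms(2) by blast
  then have "component (a * s) p = component a (p - q) * s" by (rule component_mult_right)
  then show ?case using step by (auto simp: component_add intro: sum_prods.step)
qed (simp add: component_zero sum_prods.zero)

end


section \<open>Consequences of finite generation\<close>

text \<open>Generation is encoded as linear spanning by monomials in homogeneous generators, so that
  Dickson's lemma applies to exponent vectors.\<close>

locale generated_graded_algebra = graded_algebra scale A
  for scale :: "'k::field \<Rightarrow> 'a::comm_ring_1 \<Rightarrow> 'a" and A :: "'m::ab_group_add \<Rightarrow> 'a set" +
  fixes G :: "'a set" and deg :: "'a \<Rightarrow> 'm"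
  assumes finite_G: "finite G" and G_homogeneous: "g \<in> G \<Longrightarrow> g \<in> A (deg g)"
    and span_monomials: "span (range (\<lambda>\<alpha>. \<Prod>g\<in>G. g ^ \<alpha> g)) = UNIV"
begin

definition monomial :: "('a \<Rightarrow> nat) \<Rightarrow> 'a"
  where "monomial \<alpha> = (\<Prod>g\<in>G. g ^ \<alpha> g)"

definition weight :: "('a \<Rightarrow> nat) \<Rightarrow> 'm"
  where "weight \<alpha> = (\<Sum>g\<in>G. int (\<alpha> g) \<cdot>\<^sub>Z deg g)"

lemma monomial_in: "monomial \<alpha> \<in> A (weight \<alpha>)"
proof -
  have "(\<Prod>g\<in>H. g ^ \<alpha> g) \<in> A (\<Sum>g\<in>H. int (\<alpha> g) \<cdot>\<^sub>Z deg g)" if "H \<subseteq> G" for H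
    using finite_subset[OF that finite_G] that
    by induction (auto simp: A_one intro!: mult_component A_power G_homogeneous)
  then show ?thesis by (simp add: monomial_def weight_def)
qed

lemma monomial_split:
  assumes "\<forall>g\<in>G. \<beta> g \<le> \<alpha> g"
  shows "monomial \<alpha> = monomial (\<lambda>g. \<alpha> g - \<beta> g) * monomial \<beta>"
    and "weight (\<lambda>g. \<alpha> g - \<beta> g) = weight \<alpha> - weight \<beta>"
proof -
  show "monomial \<alpha> = monomial (\<lambda>g. \<alpha> g - \<beta> g) * monomial \<beta>"
    using assms by (simp add: monomial_def flip: prod.distrib power_add)
  show "weight (\<lambda>g. \<alpha> g - \<beta> g) = weight \<alpha> - weight \<beta>"
    using assms by (simp add: weight_def of_nat_diff int_mod.scale_left_diff_distrib
        flip: sum_subtractf)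
qed

lemma component_subset_span: "A p \<subseteq> span {monomial \<alpha> | \<alpha>. weight \<alpha> = p}"
proof
  fix f assume f: "f \<in> A p"
  have *: "component f p \<in> span {monomial \<alpha> | \<alpha>. weight \<alpha> = p}" for f
  proof -
    have "f \<in> span (range monomial)"
      using span_monomials unfolding monomial_def[abs_def] by simp
    then show ?thesis
    proof (induction rule: span_induct_alt)
      case base
      show ?case by (simp add: component_zero span_zero)
    next
      case (step c x y)
      then obtain \<alpha> where x: "x = monomial \<alpha>" by blast
      have "component x p \<in> span {monomial \<alpha> | \<alpha>. weight \<alpha> = p}"
        unfolding x component_homogeneous[OF monomial_in] by (auto intro: span_base span_zero)
      then show ?case using step by (simp add: component_add component_scale span_add span_scale)
    qed
  qed
  show "f \<in> span {monomial \<alpha> | \<alpha>. weight \<alpha> = p}"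
    using *[of f] component_homogeneous[OF f, of p] by simp
qed

text \<open>By Dickson's lemma, every monomial of weight \<open>p\<close> is one of finitely many
  such monomials times a monomial of weight 0.\<close>

lemma component_fg_over_A0_aux:
  obtains E where "finite E" and "E \<subseteq> A p"
    and "\<forall>f\<in>A p. \<exists>c. (\<forall>e\<in>E. c e \<in> A 0) \<and> f = (\<Sum>e\<in>E. c e * e)"
proof -
  obtain F where F: "finite F" "F \<subseteq> {\<alpha>. weight \<alpha> = p}"
    "\<And>\<alpha>. \<alpha> \<in> {\<alpha>. weight \<alpha> = p} \<Longrightarrow> \<exists>\<beta>\<in>F. \<forall>g\<in>G. \<beta> g \<le> \<alpha> g"
    using Dickson[OF finite_G] by metis
  let ?E = "monomial ` F"
  have gen: "\<exists>c. (\<forall>e\<in>?E. c e \<in> A 0) \<and> f = (\<Sum>e\<in>?E. c e * e)" if "f \<in> A p" for f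
  proof -
    have "f \<in> span {monomial \<alpha> | \<alpha>. weight \<alpha> = p}" using that component_subset_span by blast
    then show ?thesis
    proof (induction rule: span_induct_alt)
      case base
      show ?case by (rule exI[of _ "\<lambda>_. 0"]) (simp add: A_zero)
    next
      case (step r x y)
      then obtain c where c: "\<forall>e\<in>?E. c e \<in> A 0" "y = (\<Sum>e\<in>?E. c e * e)" by blast
      from step obtain \<alpha> where x: "x = monomial \<alpha>" "weight \<alpha> = p" by blast
      then obtain \<beta> where \<beta>: "\<beta> \<in> F" "\<forall>g\<in>G. \<beta> g \<le> \<alpha> g" using F(3) by blast
      define a where "a = scale r (monomial (\<lambda>g. \<alpha> g - \<beta> g))"
      have "weight \<beta> = p" using \<beta> F(2) by blast
      then have a0: "a \<in> A 0"
        unfolding a_def using monomial_in[of "\<lambda>g. \<alpha> g - \<beta> g"] monomial_split(2)[OF \<beta>(2)] x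
        by (simp add: A_scale)
      have "scale r x = a * monomial \<beta>"
        using monomial_split(1)[OF \<beta>(2)] by (simp add: a_def x scale_mult_left)
      also have "\<dots> = (\<Sum>e\<in>?E. (if e = monomial \<beta> then a else 0) * e)"
        using F(1) \<beta>(1) by (simp add: if_distrib[of "\<lambda>t. t * _"] sum.delta cong: if_cong)
      finally have "scale r x + y = (\<Sum>e\<in>?E. ((if e = monomial \<beta> then a else 0) + c e) * e)"
        by (simp add: c(2) distrib_right sum.distrib)
      moreover have "\<forall>e\<in>?E. (if e = monomial \<beta> then a else 0) + c e \<in> A 0"
        using a0 by (intro ballI A_add bspec[OF c(1)]) (simp_all add: A_zero)
      ultimately show ?case by (intro exI conjI)
    qed
  qed
  have sub: "?E \<subseteq> A p" using F(2) monomial_in by auto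
  show thesis by (rule that[OF finite_imageI[OF F(1)] sub ballI[OF gen]])
qed

text \<open>Monomials with weight a multiple of \<open>u\<close> factor through finitely many of
  them, of multiples at most \<open>N\<close>; in large degree one of these occurs to a high power.
  \<open>N\<close> is independent of \<open>I\<close>, so one bound serves all closed points
  later.\<close>

lemma eventually_in_ideal_aux:
  "\<exists>N. \<forall>I. ring_ideal I \<longrightarrow>
    (\<forall>i f. 0 < i \<longrightarrow> i \<le> N \<longrightarrow> f \<in> A (int i \<cdot>\<^sub>Z u) \<longrightarrow> (\<exists>c. f ^ c \<in> I)) \<longrightarrow>
    (\<exists>k0. \<forall>k\<ge>k0. A (int k \<cdot>\<^sub>Z u) \<subseteq> I)"
proof -
  \<comment> \<open>\<open>None\<close> records the multiple of \<open>u\<close>, because the weight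
    need not determine it.\<close>
  let ?m = "\<lambda>\<alpha> :: 'a option \<Rightarrow> nat. monomial (\<alpha> \<circ> Some)"
  define Z where "Z = {\<alpha>. weight (\<alpha> \<circ> Some) = int (\<alpha> None) \<cdot>\<^sub>Z u \<and> \<alpha> None > 0}"
  have "finite (insert None (Some ` G))" using finite_G by simp
  then obtain F where F: "finite F" "F \<subseteq> Z"
    "\<And>\<alpha>. \<alpha> \<in> Z \<Longrightarrow> \<exists>\<beta>\<in>F. \<forall>i\<in>insert None (Some ` G). \<beta> i \<le> \<alpha> i"
    using Dickson[where S = Z] by metis
  \<comment> \<open>Elements of \<open>F\<close> are split off until the recorded multiple is 0; the
    remaining part of weight 0 is absorbed by divisibility.\<close>
  have factor: "\<exists>\<gamma>. (\<Sum>\<beta>\<in>F. \<gamma> \<beta> * \<beta> None) = \<alpha> None \<and> (\<Prod>\<beta>\<in>F. ?m \<beta> ^ \<gamma> \<beta>) dvd ?m \<alpha>"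
    if "weight (\<alpha> \<circ> Some) = int (\<alpha> None) \<cdot>\<^sub>Z u" for \<alpha>
    using that
  proof (induction "\<alpha> None" arbitrary: \<alpha> rule: less_induct)
    case less
    show ?case
    proof (cases "\<alpha> None = 0")
      case True
      then show ?thesis by (intro exI[of _ "\<lambda>_. 0"]) simp
    next
      case False
      then obtain \<beta> where \<beta>: "\<beta> \<in> F" "\<forall>i\<in>insert None (Some ` G). \<beta> i \<le> \<alpha> i"
        using less.prems F(3)[of \<alpha>] by (auto simp: Z_def)
      define \<alpha>' where "\<alpha>' i = \<alpha> i - \<beta> i" for i
      have le: "\<forall>g\<in>G. (\<beta> \<circ> Some) g \<le> (\<alpha> \<circ> Some) g" "\<beta> None \<le> \<alpha> None" using \<beta>(2) by auto
      have \<alpha>': "\<alpha>' \<circ> Some = (\<lambda>g. (\<alpha> \<circ> Some) g - (\<beta> \<circ> Some) g)" by (auto simp: \<alpha>'_def)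
      have \<beta>Z: "weight (\<beta> \<circ> Some) = int (\<beta> None) \<cdot>\<^sub>Z u" "\<beta> None > 0" using \<beta>(1) F(2) by (auto simp: Z_def)
      have "\<alpha>' None < \<alpha> None" using le \<beta>Z by (simp add: \<alpha>'_def)
      moreover have "weight (\<alpha>' \<circ> Some) = int (\<alpha>' None) \<cdot>\<^sub>Z u"
        unfolding \<alpha>' monomial_split(2)[OF le(1)] less.prems \<beta>Z(1)
        using le(2) by (simp add: \<alpha>'_def of_nat_diff int_mod.scale_left_diff_distrib)
      ultimately obtain \<gamma> where \<gamma>: "(\<Sum>\<beta>\<in>F. \<gamma> \<beta> * \<beta> None) = \<alpha>' None"
        "(\<Prod>\<beta>\<in>F. ?m \<beta> ^ \<gamma> \<beta>) dvd ?m \<alpha>'"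
        using less.hyps by blast
      define \<delta> where "\<delta> \<beta>' = \<gamma> \<beta>' + (if \<beta>' = \<beta> then 1 else 0)" for \<beta>'
      have "(\<Sum>\<beta>\<in>F. \<delta> \<beta> * \<beta> None) = \<alpha>' None + \<beta> None"
        using \<beta>(1) F(1) by (simp add: \<delta>_def distrib_right sum.distrib \<gamma>(1)
            if_distrib[of "\<lambda>t. t * _"] sum.delta cong: if_cong)
      moreover have "(\<Prod>\<beta>\<in>F. ?m \<beta> ^ \<delta> \<beta>) = (\<Prod>\<beta>\<in>F. ?m \<beta> ^ \<gamma> \<beta>) * ?m \<beta>"
        using \<beta>(1) F(1) by (simp add: \<delta>_def power_add prod.distrib
            if_distrib[of "\<lambda>t. _ ^ t"] prod.delta cong: if_cong)
      moreover have "?m \<alpha> = ?m \<alpha>' * ?m \<beta>"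
        unfolding \<alpha>' by (rule monomial_split(1)[OF le(1)])
      ultimately show ?thesis
        using \<gamma>(2) le(2) by (intro exI[of _ \<delta>]) (simp add: \<alpha>'_def mult_dvd_mono)
    qed
  qed
  define N where "N = (\<Sum>\<beta>\<in>F. \<beta> None)"
  show ?thesis
  proof (rule exI[of _ N], intro allI impI)
    fix I assume I: "ring_ideal I"
      and nil: "\<forall>i f. 0 < i \<longrightarrow> i \<le> N \<longrightarrow> f \<in> A (int i \<cdot>\<^sub>Z u) \<longrightarrow> (\<exists>c. f ^ c \<in> I)"
    have "\<exists>c. ?m \<beta> ^ c \<in> I" if "\<beta> \<in> F" for \<beta>
    proof (rule nil[rule_format])
      show "\<beta> None \<le> N" unfolding N_def by (rule member_le_sum) (use F that in auto)
      show "?m \<beta> \<in> A (int (\<beta> None) \<cdot>\<^sub>Z u)" "\<beta> None > 0"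
        using that F(2) monomial_in[of "\<beta> \<circ> Some"] by (auto simp: Z_def)
    qed
    then obtain c where c: "\<And>\<beta>. \<beta> \<in> F \<Longrightarrow> ?m \<beta> ^ c \<beta> \<in> I" by metis
    define c0 where "c0 = (\<Sum>\<beta>\<in>F. c \<beta>)"
    have c0: "?m \<beta> ^ d \<in> I" if "\<beta> \<in> F" "d \<ge> c0" for \<beta> d
    proof (rule ring_ideal_power[OF I c[OF that(1)]])
      have "c \<beta> \<le> c0" unfolding c0_def by (rule member_le_sum) (use F that in auto)
      then show "c \<beta> \<le> d" using that by simp
    qed
    \<comment> \<open>The bound exceeds \<open>c0 * N\<close>, the largest multiple possible with
      all exponents at most \<open>c0\<close>.\<close>
    have "A (int k \<cdot>\<^sub>Z u) \<subseteq> I" if k: "k \<ge> Suc (c0 * N)" for k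
    proof -
      have mon: "monomial \<alpha> \<in> I" if \<alpha>: "weight \<alpha> = int k \<cdot>\<^sub>Z u" for \<alpha>
      proof -
        define \<alpha>' where "\<alpha>' = case_option k \<alpha>"
        have \<alpha>': "\<alpha>' \<circ> Some = \<alpha>" "\<alpha>' None = k" by (auto simp: \<alpha>'_def)
        obtain \<gamma> where \<gamma>: "(\<Sum>\<beta>\<in>F. \<gamma> \<beta> * \<beta> None) = k" "(\<Prod>\<beta>\<in>F. ?m \<beta> ^ \<gamma> \<beta>) dvd monomial \<alpha>"
          using factor[of \<alpha>'] \<alpha> \<alpha>' by auto
        have "\<exists>\<beta>\<in>F. \<gamma> \<beta> > c0"
        proof (rule ccontr)
          assume "\<not> (\<exists>\<beta>\<in>F. \<gamma> \<beta> > c0)"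
          then have "(\<Sum>\<beta>\<in>F. \<gamma> \<beta> * \<beta> None) \<le> (\<Sum>\<beta>\<in>F. c0 * \<beta> None)"
            by (intro sum_mono mult_right_mono) (auto simp: not_less)
          then show False using \<gamma>(1) k by (simp add: N_def sum_distrib_left)
        qed
        then obtain \<beta> where \<beta>: "\<beta> \<in> F" "\<gamma> \<beta> > c0" by blast
        have "?m \<beta> ^ \<gamma> \<beta> dvd monomial \<alpha>"
          using \<gamma>(2) dvd_prodI[OF F(1) \<beta>(1), of "\<lambda>\<beta>. ?m \<beta> ^ \<gamma> \<beta>"] by (meson dvd_trans)
        then obtain r where "monomial \<alpha> = r * ?m \<beta> ^ \<gamma> \<beta>" by (metis dvdE mult.commute)
        moreover have "?m \<beta> ^ \<gamma> \<beta> \<in> I" using c0 \<beta> by simp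
        ultimately show ?thesis using I unfolding ring_ideal_iff by metis
      qed
      have "f \<in> I" if "f \<in> span {monomial \<alpha> | \<alpha>. weight \<alpha> = int k \<cdot>\<^sub>Z u}" for f
        using that
      proof (induction rule: span_induct_alt)
        case (step c x y)
        then show ?case using mon ring_ideal_scale[OF I] I unfolding ring_ideal_iff by blast
      qed (use I in \<open>simp add: ring_ideal_iff\<close>)
      then show ?thesis using component_subset_span by blast
    qed
    then show "\<exists>k0. \<forall>k\<ge>k0. A (int k \<cdot>\<^sub>Z u) \<subseteq> I" by blast
  qed
qed

end

context graded_algebra
begin

text \<open>The components of the generators still generate: the span of their monomials is a
  subalgebra containing each generator as a sum of components.\<close>

lemma homogeneous_generators:
  assumes "finitely_generated_algebra scale"
  obtains G deg where "generated_graded_algebra scale A G deg"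
proof -
  obtain G0 where G0: "finite G0" "subalgebra scale hull G0 = UNIV"
    using assms unfolding finitely_generated_algebra_def by blast
  define G where "G = (\<Union>f\<in>G0. component f ` {u. component f u \<noteq> 0})"
  define deg where "deg g = (SOME u. g \<in> A u)" for g
  let ?T = "span (range (\<lambda>\<alpha>. \<Prod>g\<in>G. g ^ \<alpha> g))"
  have fin: "finite G" using G0(1) by (simp add: G_def finite_component)
  have one: "1 \<in> ?T"
    by (rule span_base, rule image_eqI[of _ _ "\<lambda>_. 0"]) auto
  have mult: "x * y \<in> ?T" if "x \<in> ?T" "y \<in> ?T" for x y
    using that(1)
  proof (induction rule: span_induct_alt)
    case (step c x1 x2)
    then obtain \<alpha> where \<alpha>: "x1 = (\<Prod>g\<in>G. g ^ \<alpha> g)" by blast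
    have "x1 * y \<in> ?T" using that(2)
    proof (induction rule: span_induct_alt)
      case (step c y1 y2)
      then obtain \<beta> where \<beta>: "y1 = (\<Prod>g\<in>G. g ^ \<beta> g)" by blast
      have "x1 * y1 = (\<Prod>g\<in>G. g ^ (\<alpha> g + \<beta> g))" by (simp add: \<alpha> \<beta> power_add prod.distrib)
      then have "x1 * y1 \<in> ?T" by (auto intro!: span_base)
      then show ?case using step by (simp add: distrib_left scale_mult_right span_add span_scale)
    qed (simp add: span_zero)
    then show ?case
      using step by (simp add: distrib_right span_add span_scale flip: scale_mult_left)
  qed (simp add: span_zero)
  have "g \<in> ?T" if "g \<in> G" for g
  proof (rule span_base, rule image_eqI)
    show "g = (\<Prod>h\<in>G. h ^ (if h = g then 1 else 0))"
      using fin that by (simp add: if_distrib[of "\<lambda>t. _ ^ t"] prod.delta cong: if_cong)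
  qed simp
  then have "component f u \<in> ?T" if "f \<in> G0" for f u
    using that by (cases "component f u = 0") (auto simp: G_def span_zero)
  then have "f \<in> ?T" if "f \<in> G0" for f
    using that by (subst sum_component[of f, symmetric]) (intro span_sum)
  moreover have "subalgebra scale ?T"
    unfolding subalgebra_def using one mult by simp
  ultimately have "subalgebra scale hull G0 \<subseteq> ?T" by (intro hull_minimal) auto
  then have "?T = UNIV" using G0(2) by blast
  moreover have "g \<in> A (deg g)" if "g \<in> G" for g
  proof -
    have "\<exists>u. g \<in> A u" using that component_in by (auto simp: G_def)
    then show ?thesis unfolding deg_def by (rule someI_ex)
  qed
  ultimately have "generated_graded_algebra scale A G deg"
    using fin by unfold_locales
  then show thesis by (rule that)
qed

end


section \<open>Orbit cones\<close>

locale fg_graded_domain = graded_algebra scale A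
  for scale :: "'k::field \<Rightarrow> 'a::idom \<Rightarrow> 'a" and A :: "'m::ab_group_add \<Rightarrow> 'a set" +
  assumes finitely_generated: "finitely_generated_algebra scale"
    and torsion_free: "n \<cdot>\<^sub>Z (u :: 'm) = 0 \<Longrightarrow> n \<noteq> 0 \<Longrightarrow> u = 0"
begin

lemma component_fg_over_A0:
  obtains E where "finite E" and "E \<subseteq> A p"
    and "\<forall>f\<in>A p. \<exists>c. (\<forall>e\<in>E. c e \<in> A 0) \<and> f = (\<Sum>e\<in>E. c e * e)"
proof -
  obtain G deg where "generated_graded_algebra scale A G deg"
    using homogeneous_generators[OF finitely_generated] .
  then interpret generated_graded_algebra scale A G deg .
  show thesis by (rule component_fg_over_A0_aux[of p], rule that)
qed

lemma eventually_in_ideal: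
  "\<exists>N. \<forall>I. ring_ideal I \<longrightarrow>
    (\<forall>i f. 0 < i \<longrightarrow> i \<le> N \<longrightarrow> f \<in> A (int i \<cdot>\<^sub>Z u) \<longrightarrow> (\<exists>c. f ^ c \<in> I)) \<longrightarrow>
    (\<exists>k0. \<forall>k\<ge>k0. A (int k \<cdot>\<^sub>Z u) \<subseteq> I)"
proof -
  obtain G deg where "generated_graded_algebra scale A G deg"
    using homogeneous_generators[OF finitely_generated] .
  then interpret generated_graded_algebra scale A G deg .
  show ?thesis by (rule eventually_in_ideal_aux)
qed

section \<open>Nullstellensatz for homogeneous ideals\<close>

lemma int_scale_eq_zero_iff: "n \<cdot>\<^sub>Z (u :: 'm) = 0 \<longleftrightarrow> n = 0 \<or> u = 0"
  using torsion_free by auto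

lemma inj_to_qtensor: "to_qtensor (u :: 'm) = to_qtensor v \<longleftrightarrow> u = v"
proof
  assume "to_qtensor u = to_qtensor v"
  then obtain k where "k \<noteq> 0" "k \<cdot>\<^sub>Z u = k \<cdot>\<^sub>Z v" by (auto simp: to_qtensor_eq_iff)
  then have "k \<cdot>\<^sub>Z (u - v) = 0" by (simp add: int_mod.scale_right_diff_distrib)
  then show "u = v" using torsion_free[of k "u - v"] \<open>k \<noteq> 0\<close> by simp
qed simp

text \<open>
  If \<open>1 - f\<close> is invertible modulo the homogeneous ideal \<open>I\<close>, its inverse is the geometric series,
  which breaks off since elements have finitely many components.
\<close>

lemma nilpotent_mod_homogeneous_ideal:
  assumes I: "ring_ideal I" and hom: "\<And>f p. f \<in> I \<Longrightarrow> component f p \<in> I"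
    and f: "f \<in> A d" and d: "d \<noteq> 0" and eq: "1 = \<iota> + a * (1 - f)" and \<iota>: "\<iota> \<in> I"
  shows "\<exists>c. f ^ c \<in> I"
proof -
  define \<alpha> where "\<alpha> j = component a (j \<cdot>\<^sub>Z d)" for j
  define \<kappa> where "\<kappa> j = component \<iota> (j \<cdot>\<^sub>Z d)" for j
  have \<kappa>: "\<kappa> j \<in> I" for j unfolding \<kappa>_def by (rule hom[OF \<iota>])
  \<comment> \<open>Compare components of degree j times d in
    \<open>1 + a * f = \<iota> + a\<close>.\<close>
  have rec: "\<alpha> j = (if j = 0 then 1 else 0) + \<alpha> (j - 1) * f - \<kappa> j" for j
  proof -
    have "1 + a * f = \<iota> + a" using eq by (simp add: algebra_simps)
    then have "component (1 + a * f) (j \<cdot>\<^sub>Z d) = component (\<iota> + a) (j \<cdot>\<^sub>Z d)" by simp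
    moreover have "component (a * f) (j \<cdot>\<^sub>Z d) = \<alpha> (j - 1) * f"
      unfolding component_mult_right[OF f] \<alpha>_def by (simp add: int_mod.scale_left_diff_distrib)
    moreover have "component 1 (j \<cdot>\<^sub>Z d) = (if j = 0 then 1 else 0)"
      using d by (simp add: component_homogeneous[OF A_one] int_scale_eq_zero_iff)
    ultimately show ?thesis
      by (simp add: component_add \<alpha>_def \<kappa>_def algebra_simps split: if_splits)
  qed
  have "inj (\<lambda>j. j \<cdot>\<^sub>Z d)"
  proof (rule injI)
    fix i j assume "i \<cdot>\<^sub>Z d = j \<cdot>\<^sub>Z d"
    then have "(i - j) \<cdot>\<^sub>Z d = 0" by (simp add: int_mod.scale_left_diff_distrib)
    then show "i = j" using d by (simp add: int_scale_eq_zero_iff)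
  qed
  then have fin: "finite {j. \<alpha> j \<noteq> 0}"
    using finite_vimageI[OF finite_component[of a]] by (simp add: \<alpha>_def vimage_def)
  \<comment> \<open>Coefficients of index at least \<open>N\<close> in absolute value vanish;
    \<open>Suc\<close> keeps \<open>N\<close> positive, so that index -1 is reached below.\<close>
  define N where "N = Suc (nat (\<Sum>j | \<alpha> j \<noteq> 0. \<bar>j\<bar>))"
  have N: "\<alpha> j = 0" if "\<bar>j\<bar> \<ge> int N" for j
  proof (rule ccontr)
    assume "\<alpha> j \<noteq> 0"
    then have "\<bar>j\<bar> \<le> (\<Sum>j | \<alpha> j \<noteq> 0. \<bar>j\<bar>)" by (intro member_le_sum) (use fin in auto)
    then show False using that by (simp add: N_def)
  qed
  \<comment> \<open>The recursion starts from the zero coefficient at \<open>- N\<close> and stays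
    in \<open>I\<close> up to index -1.\<close>
  have neg: "\<alpha> (int t - int N) \<in> I" if "t < N" for t
    using that
  proof (induction t)
    case 0
    show ?case using N[of "- int N"] I by (simp add: ring_ideal_iff)
  next
    case (Suc t)
    have "\<alpha> (int (Suc t) - int N) = f * \<alpha> (int t - int N) - \<kappa> (int (Suc t) - int N)"
      using Suc.prems by (subst rec) (simp add: algebra_simps)
    then show ?case using Suc \<kappa> I by (auto simp: ring_ideal_iff intro: ring_ideal_diff[OF I])
  qed
  \<comment> \<open>The 1 at index 0 starts the geometric series modulo \<open>I\<close>; at index
    \<open>N\<close> the coefficient is 0, leaving a power of \<open>f\<close> in
    \<open>I\<close>.\<close>
  have pos: "\<alpha> (int t) - f ^ t \<in> I" for t
  proof (induction t)
    case 0
    have "\<alpha> (- 1) \<in> I" using neg[of "N - 1"] by (simp add: N_def of_nat_diff)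
    moreover have "\<alpha> 0 - 1 = f * \<alpha> (- 1) - \<kappa> 0" by (subst rec) (simp add: algebra_simps)
    ultimately show ?case using \<kappa> I by (auto simp: ring_ideal_iff intro: ring_ideal_diff[OF I])
  next
    case (Suc t)
    have "\<alpha> (int (Suc t)) - f ^ Suc t = f * (\<alpha> (int t) - f ^ t) - \<kappa> (int (Suc t))"
      by (subst rec) (simp add: algebra_simps)
    then show ?case using Suc \<kappa> I by (auto simp: ring_ideal_iff intro: ring_ideal_diff[OF I])
  qed
  have "- 1 * (\<alpha> (int N) - f ^ N) \<in> I" using pos[of N] I unfolding ring_ideal_iff by blast
  then have "f ^ N \<in> I" using N[of "int N"] by simp
  then show ?thesis by blast
qed

text \<open>
  A homogeneous substitute for the Nullstellensatz that works over any field: if no power of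
  \<open>f\<close> lies in \<open>I\<close>, then already a maximal ideal containing \<open>I\<close> and \<open>1 - f\<close> misses \<open>f\<close>.
\<close>

lemma eventually_in_homogeneous_ideal:
  assumes I: "ring_ideal I" and hom: "\<And>f p. f \<in> I \<Longrightarrow> component f p \<in> I"
    and points: "\<And>x i. x \<in> closed_points \<Longrightarrow> I \<subseteq> x \<Longrightarrow> 0 < i \<Longrightarrow> A (int i \<cdot>\<^sub>Z u) \<subseteq> x"
  shows "\<exists>k0. \<forall>k\<ge>k0. A (int k \<cdot>\<^sub>Z u) \<subseteq> I"
proof -
  have nil: "\<exists>c. f ^ c \<in> I" if i: "0 < i" and f: "f \<in> A (int i \<cdot>\<^sub>Z u)" for i f
  proof (cases "u = 0")
    \<comment> \<open>The series argument needs a nonzero degree. Here \<open>A 0\<close> contains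
      1, so no closed point contains \<open>I\<close>.\<close>
    case True
    have "1 \<in> I"
    proof (rule ccontr)
      assume "1 \<notin> I"
      then obtain x where x: "x \<in> closed_points" "I \<subseteq> x" using exists_closed_point I by blast
      then show False using points[OF x, of 1] A_one closed_point_one[OF x(1)] True by auto
    qed
    then show ?thesis by (intro exI[of _ 0]) simp
  next
    case False
    let ?J = "{\<iota> + b * (1 - f) | \<iota> b. \<iota> \<in> I}"
    have J: "ring_ideal ?J" by (rule ring_ideal_add_multiples[OF I])
    have "1 \<in> ?J"
    proof (rule ccontr)
      assume "1 \<notin> ?J"
      then obtain x where x: "x \<in> closed_points" "?J \<subseteq> x" by (rule exists_closed_point[OF J])
      have "\<iota> \<in> ?J" if "\<iota> \<in> I" for \<iota>
      proof -
        have "\<iota> = \<iota> + 0 * (1 - f) \<and> \<iota> \<in> I" using that by simp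
        then show ?thesis by blast
      qed
      then have "I \<subseteq> x" using x(2) by blast
      then have "f \<in> x" using points[OF x(1) _ i] f by blast
      have "1 - f = 0 + 1 * (1 - f) \<and> 0 \<in> I" using I by (simp add: ring_ideal_iff)
      then have "1 - f \<in> x" using x(2) by blast
      then have "(1 - f) + f \<in> x"
        using \<open>f \<in> x\<close> closed_point_ideal[OF x(1)] unfolding ring_ideal_iff by blast
      then show False using closed_point_one[OF x(1)] by simp
    qed
    then obtain \<iota> b where "1 = \<iota> + b * (1 - f)" "\<iota> \<in> I" by blast
    moreover have "int i \<cdot>\<^sub>Z u \<noteq> 0" using False i by (simp add: int_scale_eq_zero_iff)
    ultimately show ?thesis using nilpotent_mod_homogeneous_ideal[OF I hom f] by blast
  qed
  obtain N where N: "\<forall>i f. 0 < i \<longrightarrow> i \<le> N \<longrightarrow> f \<in> A (int i \<cdot>\<^sub>Z u) \<longrightarrow> (\<exists>c. f ^ c \<in> I) \<Longrightarrow>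
      \<exists>k0. \<forall>k\<ge>k0. A (int k \<cdot>\<^sub>Z u) \<subseteq> I"
    using eventually_in_ideal[of u] I by blast
  show ?thesis by (rule N) (use nil in blast)
qed

section \<open>Lattice points of weight cones and orbit cones\<close>

lemma convex_cone_Q_hull_to_qtensor_iff:
  fixes u :: 'm
  assumes "0 \<in> W" and "\<And>u v. u \<in> W \<Longrightarrow> v \<in> W \<Longrightarrow> u + v \<in> W"
  shows "to_qtensor u \<in> convex_cone_Q hull (to_qtensor ` W) \<longleftrightarrow> (\<exists>n>0. int n \<cdot>\<^sub>Z u \<in> W)"
proof -
  have "of_nat n \<cdot>\<^sub>Q to_qtensor u = to_qtensor v \<longleftrightarrow> int n \<cdot>\<^sub>Z u = v" for n v
    using inj_to_qtensor[of "int n \<cdot>\<^sub>Z u" v] by (simp add: to_qtensor_scale)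
  then show ?thesis using convex_cone_Q_hull_to_qtensor[OF assms, of "to_qtensor u"] by auto
qed

lemma weight_cone_image: "weight_cone A = convex_cone_Q hull (to_qtensor ` {u. A u \<noteq> {0}})"
  unfolding weight_cone_def by (simp add: setcompr_eq_image)

text \<open>The weights with nonzero component form a monoid because the algebra is a
  domain.\<close>

lemma weight_cone_iff:
  "w \<in> weight_cone A \<longleftrightarrow> (\<exists>n>0. \<exists>u\<in>{u. A u \<noteq> {0}}. of_nat n \<cdot>\<^sub>Q w = to_qtensor u)"
  unfolding weight_cone_image
proof (rule convex_cone_Q_hull_to_qtensor)
  show "0 \<in> {u. A u \<noteq> {0}}" using A_one by auto
  fix u v assume "u \<in> {u. A u \<noteq> {0}}" "v \<in> {u. A u \<noteq> {0}}"
  then obtain f g where "f \<in> A u" "f \<noteq> 0" "g \<in> A v" "g \<noteq> 0" using A_zero by blast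
  then have "f * g \<in> A (u + v)" "f * g \<noteq> 0" by (auto intro: mult_component)
  then show "u + v \<in> {u. A u \<noteq> {0}}" unfolding mem_Collect_eq by (metis singletonD)
qed

lemma orbit_cone_image:
  assumes "x \<in> closed_points"
  shows "orbit_cone A x = convex_cone_Q hull (to_qtensor ` {u. \<exists>f\<in>A u. f \<notin> x})"
proof -
  have "to_qtensor u \<in> weight_cone A" if "f \<in> A u" "f \<notin> x" for f u
  proof -
    have "A u \<noteq> {0}"
      using that closed_point_ideal[OF assms] by (auto simp: ring_ideal_iff)
    then show ?thesis unfolding weight_cone_image by (intro hull_inc imageI) simp
  qed
  then have "{to_qtensor u | u. to_qtensor u \<in> weight_cone A \<and> (\<exists>f\<in>A u. f \<notin> x)} =
      to_qtensor ` {u. \<exists>f\<in>A u. f \<notin> x}" by blast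
  then show ?thesis unfolding orbit_cone_def by simp
qed

text \<open>The degrees of functions not vanishing at \<open>x\<close> form a monoid because
  \<open>x\<close> is prime. The right-hand side is semistability of \<open>x\<close> with respect
  to \<open>u\<close>.\<close>

lemma orbit_cone_iff:
  assumes x: "x \<in> closed_points"
  shows "to_qtensor u \<in> orbit_cone A x \<longleftrightarrow> (\<exists>n>0. \<exists>f\<in>A (int n \<cdot>\<^sub>Z u). f \<notin> x)"
proof -
  have "0 \<in> {u. \<exists>f\<in>A u. f \<notin> x}" using A_one closed_point_one[OF x] by blast
  moreover have "u + v \<in> {u. \<exists>f\<in>A u. f \<notin> x}"
    if "u \<in> {u. \<exists>f\<in>A u. f \<notin> x}" "v \<in> {u. \<exists>f\<in>A u. f \<notin> x}" for u v
    using that mult_component closed_point_prime[OF x] by blast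
  ultimately show ?thesis
    unfolding orbit_cone_image[OF x] by (subst convex_cone_Q_hull_to_qtensor_iff) auto
qed

lemma convex_cone_Q_GIT_cone: "convex_cone_Q (GIT_cone A w)"
proof -
  have "convex_cone_Q (orbit_cone A x)" for x
    unfolding orbit_cone_def by (rule convex_cone_Q_hull)
  then show ?thesis by (simp add: GIT_cone_def convex_cone_Q_def)
qed

text \<open>
  Let \<open>J\<close> be generated by the elements of degree in \<open>\<nat> n0 (p + q)\<close> vanishing at \<open>x\<close>. A point
  \<open>y\<close> containing \<open>J\<close> with \<open>w\<close> in its orbit cone exists because the quotient of the
  \<open>w\<close>-semistable points is proper over \<open>Spec (A 0)\<close>; algebraically, Nakayama's lemma
  for the finitely generated \<open>A 0\<close>-module \<open>A (k w')\<close> says so. Both \<open>p\<close> and \<open>q\<close> lie in the orbit cone of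
  \<open>y\<close>, so some product of elements of degrees in \<open>\<nat> p\<close> and \<open>\<nat> q\<close> is not in \<open>J\<close>, hence not in \<open>x\<close>.
\<close>

lemma GIT_cone_summand:
  assumes w: "w \<in> weight_cone A" and p: "to_qtensor p \<in> GIT_cone A w"
    and q: "to_qtensor q \<in> GIT_cone A w"
    and x: "x \<in> closed_points" and pq: "to_qtensor (p + q) \<in> orbit_cone A x"
  shows "to_qtensor p \<in> orbit_cone A x"
proof -
  let ?u = "p + q"
  note id = closed_point_ideal[OF x]
  obtain n0 h where n0: "n0 > 0" and h: "h \<in> A (int n0 \<cdot>\<^sub>Z ?u)" "h \<notin> x"
    using pq unfolding orbit_cone_iff[OF x] by blast
  obtain n w' where n: "n > 0" "of_nat n \<cdot>\<^sub>Q w = to_qtensor w'" and w': "A w' \<noteq> {0}"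
    using w unfolding weight_cone_iff by blast
  have w_iff: "to_qtensor w' \<in> orbit_cone A y \<longleftrightarrow> w \<in> orbit_cone A y" for y
    unfolding orbit_cone_def n(2)[symmetric]
    using n(1) by (simp only: convex_cone_Q_scale_iff[OF convex_cone_Q_hull] of_nat_0_less_iff)
  \<comment> \<open>Degrees run over multiples of \<open>n0\<close> so that powers of
    \<open>h\<close> have the degrees of the generators.\<close>
  define S where "S = (\<Union>i. A (int i \<cdot>\<^sub>Z int n0 \<cdot>\<^sub>Z ?u) \<inter> x)"
  have J: "ring_ideal (UNIV \<odot> S)" by (rule ring_ideal_UNIV_sum_prods)
  have homJ: "component f r \<in> UNIV \<odot> S" if "f \<in> UNIV \<odot> S" for f r
    using that by (rule homogeneous_ideal_component) (auto simp: S_def)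
  \<comment> \<open>In a summand \<open>a * s\<close>, the factor \<open>h ^ i\<close> makes up for
    the degree of \<open>s\<close>, while \<open>s\<close> times the remaining power of
    \<open>h\<close> stays in \<open>x\<close>.\<close>
  have clear: "\<exists>T0. \<forall>T\<ge>T0. component f r * h ^ T \<in> A r \<odot> x" if "f \<in> UNIV \<odot> S" for f r
    using that
  proof induction
    case zero
    show ?case by (simp add: component_zero sum_prods.zero)
  next
    case (step a s f)
    then obtain T0 where T0: "\<And>T. T \<ge> T0 \<Longrightarrow> component f r * h ^ T \<in> A r \<odot> x" by blast
    from step obtain i where s: "s \<in> A (int i \<cdot>\<^sub>Z int n0 \<cdot>\<^sub>Z ?u)" "s \<in> x"
      unfolding S_def by blast
    let ?d = "int i \<cdot>\<^sub>Z int n0 \<cdot>\<^sub>Z ?u"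
    have "component (a * s + f) r * h ^ T \<in> A r \<odot> x" if T: "T \<ge> max T0 i" for T
    proof -
      have "component a (r - ?d) * h ^ i \<in> A (r - ?d + ?d)"
        by (intro mult_component component_in A_power h)
      then have "component a (r - ?d) * h ^ i \<in> A r" by simp
      moreover have "s * h ^ (T - i) \<in> x"
        using s(2) id unfolding ring_ideal_iff by (metis mult.commute)
      moreover have "h ^ T = h ^ i * h ^ (T - i)" using T by (simp flip: power_add)
      then have "component (a * s + f) r * h ^ T =
          (component a (r - ?d) * h ^ i) * (s * h ^ (T - i)) + component f r * h ^ T"
        by (simp add: component_add component_mult_right[OF s(1)] algebra_simps)
      ultimately show ?thesis using T0 T by (auto intro: sum_prods.step)
    qed
    then show ?case by blast
  qed
  have "\<exists>y\<in>closed_points. UNIV \<odot> S \<subseteq> y \<and> to_qtensor w' \<in> orbit_cone A y"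
  proof (rule ccontr)
    \<comment> \<open>The homogeneous Nullstellensatz then puts the component of some multiple of
      \<open>w'\<close> into the ideal; it will be shown to vanish, against \<open>A w'\<close>
      being nonzero in a domain.\<close>
    assume none: "\<not> ?thesis"
    have "\<exists>k0. \<forall>k\<ge>k0. A (int k \<cdot>\<^sub>Z w') \<subseteq> UNIV \<odot> S"
      by (rule eventually_in_homogeneous_ideal[OF J homJ]) (use none orbit_cone_iff in blast)+
    then obtain k where k: "A (int k \<cdot>\<^sub>Z w') \<subseteq> UNIV \<odot> S" by blast
    let ?r = "int k \<cdot>\<^sub>Z w'"
    obtain E where E: "finite E" "E \<subseteq> A ?r"
      "\<forall>f\<in>A ?r. \<exists>c. (\<forall>e\<in>E. c e \<in> A 0) \<and> f = (\<Sum>e\<in>E. c e * e)"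
      by (rule component_fg_over_A0)
    have "\<forall>e\<in>E. \<exists>T0. \<forall>T\<ge>T0. e * h ^ T \<in> A ?r \<odot> x"
    proof
      fix e assume e: "e \<in> E"
      then have "component e ?r = e" using E(2) component_homogeneous[of e ?r ?r] by auto
      moreover have "e \<in> UNIV \<odot> S" using e E(2) k by blast
      ultimately show "\<exists>T0. \<forall>T\<ge>T0. e * h ^ T \<in> A ?r \<odot> x" using clear[of e ?r] by simp
    qed
    then obtain T0 where T0: "\<And>e T. e \<in> E \<Longrightarrow> T \<ge> T0 e \<Longrightarrow> e * h ^ T \<in> A ?r \<odot> x" by metis
    define T where "T = (\<Sum>e\<in>E. T0 e)"
    have T: "e * h ^ T \<in> A ?r \<odot> x" if "e \<in> E" for e
      by (rule T0[OF that]) (use that E(1) in \<open>auto simp: T_def intro: member_le_sum\<close>)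
    have coeffs: "\<exists>c. (\<forall>e\<in>E. c e \<in> x) \<and> f = (\<Sum>e\<in>E. c e * e)" if "f \<in> A ?r \<odot> x" for f
      using that
    proof induction
      case zero
      show ?case by (rule exI[of _ "\<lambda>_. 0"]) (use id in \<open>simp add: ring_ideal_iff\<close>)
    next
      case (step a s f)
      obtain c where c: "\<forall>e\<in>E. c e \<in> x" "f = (\<Sum>e\<in>E. c e * e)" using step by blast
      obtain b where b: "a = (\<Sum>e\<in>E. b e * e)" using bspec[OF E(3) step.hyps(1)] by blast
      have "a * s + f = (\<Sum>e\<in>E. (b e * s + c e) * e)"
        by (simp add: b c(2) sum.distrib sum_distrib_left algebra_simps)
      moreover have "\<forall>e\<in>E. b e * s + c e \<in> x"
        using c(1) step.hyps(2) id unfolding ring_ideal_iff by blast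
      ultimately show ?case by (intro exI[of _ "\<lambda>e. b e * s + c e"] conjI)
    qed
    have "\<forall>e\<in>E. \<exists>c. (\<forall>e'\<in>E. c e' \<in> x) \<and> e * h ^ T = (\<Sum>e'\<in>E. c e' * e')"
      using coeffs T by blast
    then obtain c where c: "\<And>e e'. e \<in> E \<Longrightarrow> e' \<in> E \<Longrightarrow> c e e' \<in> x"
      "\<And>e. e \<in> E \<Longrightarrow> e * h ^ T = (\<Sum>e'\<in>E. c e e' * e')"
      by metis
    \<comment> \<open>The matrix of the relations for \<open>e * h ^ T\<close>: modulo
      \<open>x\<close> it is \<open>h ^ T\<close> times the identity.\<close>
    define D where "D e e' = (if e' = e then h ^ T else 0) - c e e'" for e e'
    have zero: "\<forall>e\<in>E. e = 0"
    proof (rule linear_system_trivial[OF E(1) x, of D])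
      fix e assume e: "e \<in> E"
      have "(\<Sum>e'\<in>E. D e e' * e') = (\<Sum>e'\<in>E. if e' = e then h ^ T * e' else 0) - e * h ^ T"
        unfolding c(2)[OF e] sum_subtractf[symmetric] by (rule sum.cong) (auto simp: D_def algebra_simps)
      then show "(\<Sum>e'\<in>E. D e e' * e') = 0" using e E(1) by (simp add: mult.commute)
      show "D e e \<notin> x"
      proof
        assume "D e e \<in> x"
        then have "D e e + c e e \<in> x" using c(1)[OF e e] id unfolding ring_ideal_iff by blast
        then show False using closed_point_power_notin[OF x h(2)] by (simp add: D_def)
      qed
      fix e' assume e': "e' \<in> E" "e \<noteq> e'"
      then have "D e e' = - 1 * c e e'" by (simp add: D_def)
      then show "D e e' \<in> x" using c(1)[OF e e'(1)] id unfolding ring_ideal_iff by metis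
    qed
    have "f = 0" if f: "f \<in> A ?r" for f
    proof -
      obtain c where "f = (\<Sum>e\<in>E. c e * e)" using bspec[OF E(3) f] by blast
      also have "\<dots> = 0" by (rule sum.neutral) (use zero in fastforce)
      finally show ?thesis .
    qed
    moreover obtain f where "f \<in> A w'" "f \<noteq> 0" using w' A_zero by blast
    then have "f ^ k \<in> A ?r" "f ^ k \<noteq> 0" by (auto intro: A_power)
    ultimately show False by blast
  qed
  then obtain y where y: "y \<in> closed_points" and Jy: "UNIV \<odot> S \<subseteq> y"
    and wy: "w \<in> orbit_cone A y" using w_iff by blast
  have "to_qtensor p \<in> orbit_cone A y" "to_qtensor q \<in> orbit_cone A y"
    using p q y wy unfolding GIT_cone_def by auto
  then obtain i f j g where f: "i > 0" "f \<in> A (int i \<cdot>\<^sub>Z p)" "f \<notin> y"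
    and g: "j > 0" "g \<in> A (int j \<cdot>\<^sub>Z q)" "g \<notin> y"
    unfolding orbit_cone_iff[OF y] by blast
  \<comment> \<open>These powers bring both degrees to the multiple \<open>i * j * n0\<close>, so
    that the product has a degree occurring in \<open>S\<close>.\<close>
  have f': "f ^ (j * n0) \<in> A (int (i * j * n0) \<cdot>\<^sub>Z p)" and g': "g ^ (i * n0) \<in> A (int (i * j * n0) \<cdot>\<^sub>Z q)"
    using A_power[OF f(2), of "j * n0"] A_power[OF g(2), of "i * n0"] by (simp_all add: mult_ac)
  have fg: "f ^ (j * n0) * g ^ (i * n0) \<in> A (int (i * j) \<cdot>\<^sub>Z int n0 \<cdot>\<^sub>Z ?u)"
    using mult_component[OF f' g'] by (simp add: int_mod.scale_right_distrib mult_ac)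
  have "f ^ (j * n0) * g ^ (i * n0) \<notin> y"
    using closed_point_prime[OF y] closed_point_power_notin[OF y] f g by blast
  then have "f ^ (j * n0) * g ^ (i * n0) \<notin> S" using Jy UNIV_sum_prods_inc by blast
  then have "f ^ (j * n0) * g ^ (i * n0) \<notin> x" using fg unfolding S_def by blast
  then have "f ^ (j * n0) \<notin> x" using id unfolding ring_ideal_iff by (metis mult.commute)
  then show ?thesis
    unfolding orbit_cone_iff[OF x] using f' f(1) g(1) n0
    by (intro exI[of _ "i * j * n0"] conjI bexI) auto
qed


section \<open>Generating pairs\<close>

text \<open>A power of a function not vanishing at \<open>x\<close> is a sum of products; one
  product does not vanish at \<open>x\<close>, hence neither do its factors.\<close>

lemma generating_pair_orbit_cones:
  assumes gp: "generating_pair A u v" and x: "x \<in> closed_points"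
    and uv: "to_qtensor (u + v) \<in> orbit_cone A x"
  shows "to_qtensor u \<in> orbit_cone A x \<and> to_qtensor v \<in> orbit_cone A x"
proof -
  note id = closed_point_ideal[OF x]
  obtain m where m: "m > 0" and surj: "\<And>k. k > 0 \<Longrightarrow>
      A ((k * m) \<cdot>\<^sub>Z (u + v)) \<subseteq> A ((k * m) \<cdot>\<^sub>Z u) \<odot> A ((k * m) \<cdot>\<^sub>Z v)"
    using gp unfolding generating_pair_def mult_map_surj_iff by blast
  obtain n f where n: "n > 0" and f: "f \<in> A (int n \<cdot>\<^sub>Z (u + v))" "f \<notin> x"
    using uv unfolding orbit_cone_iff[OF x] by blast
  \<comment> \<open>The generating condition is used with \<open>k = n\<close>; the power
    \<open>m\<close> of \<open>f\<close> reaches this degree.\<close>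
  let ?N = "int n * m"
  have N: "?N = int (n * nat m)" "n * nat m > 0" using m n by simp_all
  have "f ^ nat m \<in> A (?N \<cdot>\<^sub>Z (u + v))"
    using A_power[OF f(1), of "nat m"] m by (simp add: mult.commute)
  then have "f ^ nat m \<in> A (?N \<cdot>\<^sub>Z u) \<odot> A (?N \<cdot>\<^sub>Z v)"
    using surj[of "int n"] n by (meson of_nat_0_less_iff subsetD)
  moreover have "f ^ nat m \<notin> x" using closed_point_power_notin[OF x f(2)] .
  ultimately have "(\<exists>g\<in>A (?N \<cdot>\<^sub>Z u). g \<notin> x) \<and> (\<exists>g\<in>A (?N \<cdot>\<^sub>Z v). g \<notin> x)"
  proof induction
    case zero
    then show ?case using id by (simp add: ring_ideal_iff)
  next
    case (step g g' h)
    then show ?case using id unfolding ring_ideal_iff by (metis mult.commute)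
  qed
  then show ?thesis unfolding orbit_cone_iff[OF x] using N by metis
qed

text \<open>The factorial of the uniform bound is a multiple of every degree up to it, so one degree
  tests all \<open>x\<close>. The factor \<open>c\<close> allows common multiples for several
  weights.\<close>

lemma exists_detecting_degree:
  obtains n :: nat where "n > 0"
    and "\<And>x c i. x \<in> closed_points \<Longrightarrow> c > 0 \<Longrightarrow> A (int (c * n) \<cdot>\<^sub>Z u) \<subseteq> x \<Longrightarrow> i > 0 \<Longrightarrow>
      A (int i \<cdot>\<^sub>Z u) \<subseteq> x"
proof -
  obtain N where N: "\<And>I. ring_ideal I \<Longrightarrow>
      (\<forall>i f. 0 < i \<longrightarrow> i \<le> N \<longrightarrow> f \<in> A (int i \<cdot>\<^sub>Z u) \<longrightarrow> (\<exists>c. f ^ c \<in> I)) \<longrightarrow>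
      (\<exists>k0. \<forall>k\<ge>k0. A (int k \<cdot>\<^sub>Z u) \<subseteq> I)"
    using eventually_in_ideal[of u] by blast
  have "A (int i \<cdot>\<^sub>Z u) \<subseteq> x"
    if x: "x \<in> closed_points" and c: "c > 0" and sub: "A (int (c * fact N) \<cdot>\<^sub>Z u) \<subseteq> x" and i: "i > 0"
    for x c i
  proof -
    have nil: "\<exists>d. f ^ d \<in> x" if "0 < j" "j \<le> N" "f \<in> A (int j \<cdot>\<^sub>Z u)" for j f
    proof -
      have "j dvd fact N" using that by (intro dvd_fact) auto
      then obtain d where "fact N = j * d" by (auto simp: dvd_def)
      then have d: "c * fact N = c * d * j" by (simp add: mult_ac)
      have "f ^ (c * d) \<in> A (int (c * fact N) \<cdot>\<^sub>Z u)"
        using A_power[OF that(3), of "c * d"] by (simp only: d int_mod.scale_scale of_nat_mult)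
      then show ?thesis using sub by blast
    qed
    obtain k0 where k0: "\<And>k. k \<ge> k0 \<Longrightarrow> A (int k \<cdot>\<^sub>Z u) \<subseteq> x"
      using N[OF closed_point_ideal[OF x]] nil by blast
    show ?thesis
    proof
      fix f assume "f \<in> A (int i \<cdot>\<^sub>Z u)"
      then have "f ^ k0 \<in> A (int (k0 * i) \<cdot>\<^sub>Z u)" using A_power by fastforce
      moreover have "k0 * i \<ge> k0" using i by simp
      ultimately have "f ^ k0 \<in> x" using k0 by blast
      then show "f \<in> x" using closed_point_power_notin[OF x] by blast
    qed
  qed
  then show thesis using that[of "fact N"] by simp
qed

lemma not_orbit_cone_iff:
  assumes "x \<in> closed_points"
  shows "to_qtensor u \<notin> orbit_cone A x \<longleftrightarrow> (\<forall>i>0. A (int i \<cdot>\<^sub>Z u) \<subseteq> x)"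
  unfolding orbit_cone_iff[OF assms] by blast

text \<open>
  Write \<open>B i j\<close> for the component of degree \<open>i u + j v\<close>. The Nullstellensatz gives
  \<open>B k k \<subseteq> B (k - q) (k - q) \<odot> B q 0 \<odot> B 0 q\<close> for large \<open>k\<close> and \<open>B q 0 \<subseteq> B q (- n) \<odot> B 0 n\<close>. Each use of
  both moves degree \<open>(q + n) v\<close> into the right factor, so that \<open>k = l (q + n)\<close> is exhausted after
  \<open>l\<close> steps, and \<open>k - l q = l n\<close> stays large.
\<close>

lemma generating_pairI:
  assumes cones: "to_qtensor u \<in> weight_cone A" "to_qtensor v \<in> weight_cone A"
    and uv: "\<And>x. x \<in> closed_points \<Longrightarrow> to_qtensor (u + v) \<in> orbit_cone A x \<Longrightarrow>
      to_qtensor u \<in> orbit_cone A x"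
    and u: "\<And>x. x \<in> closed_points \<Longrightarrow> to_qtensor u \<in> orbit_cone A x \<Longrightarrow>
      to_qtensor v \<in> orbit_cone A x"
  shows "generating_pair A u v"
proof -
  define B where "B i j = A (i \<cdot>\<^sub>Z u + j \<cdot>\<^sub>Z v)" for i j :: int
  have B_prod: "B i j \<odot> B i' j' \<subseteq> B (i + i') (j + j')" for i j i' j'
  proof -
    have "(i + i') \<cdot>\<^sub>Z u + (j + j') \<cdot>\<^sub>Z v = (i \<cdot>\<^sub>Z u + j \<cdot>\<^sub>Z v) + (i' \<cdot>\<^sub>Z u + j' \<cdot>\<^sub>Z v)"
      by (simp add: int_mod.scale_left_distrib add_ac)
    then show ?thesis unfolding B_def by (simp only: A_sum_prods)
  qed
  have B_one: "1 \<in> B 0 0" by (simp add: B_def A_one)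
  \<comment> \<open>The Nullstellensatz in factored form: if vanishing of \<open>S\<close> expels
    \<open>s\<close> from the orbit cone, high multiples of \<open>s\<close> factor through
    \<open>S\<close>.\<close>
  have split: "\<exists>k0. \<forall>k\<ge>k0. A (int k \<cdot>\<^sub>Z s) \<subseteq> A (int k \<cdot>\<^sub>Z s - d) \<odot> S"
    if S: "S \<subseteq> A d" and vanish: "\<And>x. x \<in> closed_points \<Longrightarrow> S \<subseteq> x \<Longrightarrow> to_qtensor s \<notin> orbit_cone A x"
    for s d S
  proof -
    have "\<exists>k0. \<forall>k\<ge>k0. A (int k \<cdot>\<^sub>Z s) \<subseteq> UNIV \<odot> S"
    proof (rule eventually_in_homogeneous_ideal)
      show "component f p \<in> UNIV \<odot> S" if "f \<in> UNIV \<odot> S" for f p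
        using that by (rule homogeneous_ideal_component) (use S in blast)
      show "A (int i \<cdot>\<^sub>Z s) \<subseteq> x" if "x \<in> closed_points" "UNIV \<odot> S \<subseteq> x" "0 < i" for x i
        using that vanish[of x] UNIV_sum_prods_inc[of S] not_orbit_cone_iff[of x s] by blast
    qed (rule ring_ideal_UNIV_sum_prods)
    then obtain k0 where k0: "\<And>k. k \<ge> k0 \<Longrightarrow> A (int k \<cdot>\<^sub>Z s) \<subseteq> UNIV \<odot> S" by blast
    have "A (int k \<cdot>\<^sub>Z s) \<subseteq> A (int k \<cdot>\<^sub>Z s - d) \<odot> S" if k: "k \<ge> k0" for k
    proof
      fix f assume f: "f \<in> A (int k \<cdot>\<^sub>Z s)"
      then have "component f (int k \<cdot>\<^sub>Z s) \<in> A (int k \<cdot>\<^sub>Z s - d) \<odot> S"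
        using sum_prods_component[OF _ S] k0[OF k] by blast
      then show "f \<in> A (int k \<cdot>\<^sub>Z s - d) \<odot> S" by (simp add: component_homogeneous[OF f])
    qed
    then show ?thesis by blast
  qed
  obtain nu where nu: "nu > 0" and nu_vanish: "\<And>x c. x \<in> closed_points \<Longrightarrow> c > 0 \<Longrightarrow>
      A (int (c * nu) \<cdot>\<^sub>Z u) \<subseteq> x \<Longrightarrow> to_qtensor u \<notin> orbit_cone A x"
    using exists_detecting_degree[of u] not_orbit_cone_iff by metis
  obtain n where n: "n > 0" and n_vanish: "\<And>x c. x \<in> closed_points \<Longrightarrow> c > 0 \<Longrightarrow>
      A (int (c * n) \<cdot>\<^sub>Z v) \<subseteq> x \<Longrightarrow> to_qtensor v \<notin> orbit_cone A x"
    using exists_detecting_degree[of v] not_orbit_cone_iff by metis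
  have "\<exists>k1. \<forall>k\<ge>k1. A (int k \<cdot>\<^sub>Z u) \<subseteq> A (int k \<cdot>\<^sub>Z u - int n \<cdot>\<^sub>Z v) \<odot> A (int n \<cdot>\<^sub>Z v)"
    by (rule split) (use n_vanish[of _ 1] u in auto)
  then obtain k1 where k1: "\<And>k. k \<ge> k1 \<Longrightarrow> B (int k) 0 \<subseteq> B (int k) (- int n) \<odot> B 0 (int n)"
    by (auto simp: B_def)
  \<comment> \<open>A positive multiple of both detecting degrees, and at least \<open>k1\<close> so
    that \<open>B q 0\<close> can be split.\<close>
  define q where "q = Suc k1 * nu * n"
  have "Suc k1 * 1 \<le> Suc k1 * (nu * n)" by (rule mult_le_mono2) (use nu n in simp)
  then have q: "q \<ge> k1" by (simp only: q_def mult.assoc mult_1_right Suc_leD)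
  have q_eq: "q = Suc k1 * n * nu" by (simp only: q_def mult_ac)
  \<comment> \<open>As \<open>x\<close> is prime, one of the two components vanishes; if it is the
    second, \<open>v\<close> leaves the orbit cone and \<open>u\<close> with it.\<close>
  have q_vanish: "to_qtensor u \<notin> orbit_cone A x"
    if x: "x \<in> closed_points" and sub: "A (int q \<cdot>\<^sub>Z u) \<odot> A (int q \<cdot>\<^sub>Z v) \<subseteq> x" for x
  proof (cases "A (int q \<cdot>\<^sub>Z u) \<subseteq> x")
    case True
    then show ?thesis using nu_vanish[OF x, of "Suc k1 * n"] n by (simp add: q_eq del: mult_Suc)
  next
    case False
    then have "A (int q \<cdot>\<^sub>Z v) \<subseteq> x"
      using sub sum_prods_mult closed_point_prime[OF x] by blast
    then have "to_qtensor v \<notin> orbit_cone A x"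
      using n_vanish[OF x, of "Suc k1 * nu"] nu by (simp add: q_def del: mult_Suc)
    then show ?thesis using u[OF x] by blast
  qed
  have "\<exists>k0. \<forall>k\<ge>k0. A (int k \<cdot>\<^sub>Z (u + v)) \<subseteq>
      A (int k \<cdot>\<^sub>Z (u + v) - (int q \<cdot>\<^sub>Z u + int q \<cdot>\<^sub>Z v)) \<odot> (A (int q \<cdot>\<^sub>Z u) \<odot> A (int q \<cdot>\<^sub>Z v))"
    by (rule split[OF A_sum_prods]) (use q_vanish uv in blast)
  then obtain k0 where k0: "\<And>k. k \<ge> k0 \<Longrightarrow>
      B (int k) (int k) \<subseteq> B (int k - int q) (int k - int q) \<odot> (B (int q) 0 \<odot> B 0 (int q))"
    by (auto simp: B_def int_mod.scale_right_distrib int_mod.scale_left_diff_distrib algebra_simps)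
  have step: "B (int k) (int k) \<subseteq>
      B (int k) (int k - int l * (int q + int n)) \<odot> B 0 (int l * (int q + int n))"
    if "k \<ge> k0 + l * q" for k l
    using that
  proof (induction l arbitrary: k)
    case 0
    then show ?case using sum_prods_mult[OF _ B_one] by fastforce
  next
    case (Suc l)
    define k' where "k' = k - q"
    have k': "k' \<ge> k0 + l * q" "int k' = int k - int q" "k \<ge> k0"
      using Suc.prems by (auto simp: k'_def)
    let ?d = "int l * (int q + int n)"
    have "B (int k) (int k) \<subseteq> B (int k') (int k') \<odot> (B (int q) 0 \<odot> B 0 (int q))"
      unfolding k'(2) by (rule k0[OF k'(3)])
    \<comment> \<open>The induction hypothesis treats the first factor, and the inclusion from
      \<open>k1\<close> splits \<open>B q 0\<close>.\<close>
    also have "\<dots> \<subseteq> (B (int k') (int k' - ?d) \<odot> B 0 ?d) \<odot>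
        ((B (int q) (- int n) \<odot> B 0 (int n)) \<odot> B 0 (int q))"
      by (intro sum_prods_mono Suc.IH k1 order_refl k'(1) q)
    also have "\<dots> = (B (int k') (int k' - ?d) \<odot> B (int q) (- int n)) \<odot>
        (B 0 ?d \<odot> (B 0 (int n) \<odot> B 0 (int q)))"
      by (simp only: sum_prods_assoc sum_prods_left_commute)
    also have "\<dots> \<subseteq> B (int k' + int q) (int k' - ?d + - int n) \<odot>
        B (0 + (0 + 0)) (?d + (int n + int q))"
      by (intro sum_prods_mono B_prod order_trans[OF sum_prods_mono[OF order_refl B_prod] B_prod])
    also have "\<dots> = B (int k) (int k - int (Suc l) * (int q + int n)) \<odot>
        B 0 (int (Suc l) * (int q + int n))"
      by (simp add: k'(2) algebra_simps)
    finally show ?case .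
  qed
  \<comment> \<open>For degree \<open>k * m\<close>, exactly \<open>l = k * Suc k0\<close> steps use
    up the multiple of \<open>v\<close> on the left; \<open>l * n\<close> is at least
    \<open>k0\<close>, as \<open>step\<close> requires.\<close>
  define m where "m = int (Suc k0) * (int q + int n)"
  have "mult_map_surj (A ((k * m) \<cdot>\<^sub>Z u)) (A ((k * m) \<cdot>\<^sub>Z v)) (A ((k * m) \<cdot>\<^sub>Z (u + v)))"
    if k: "k > 0" for k
  proof -
    define l where "l = nat k * Suc k0"
    have l: "k * m = int l * (int q + int n)" "int l * (int q + int n) = int (l * (q + n))"
      using k by (simp_all add: l_def m_def algebra_simps)
    have "1 * Suc k0 \<le> l" unfolding l_def by (rule mult_le_mono1) (use k in simp)
    then have "k0 \<le> l" by simp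
    also have "\<dots> \<le> l * n" using n by simp
    finally have "k0 + l * q \<le> l * (q + n)" by (simp add: distrib_left)
    from step[OF this] have "B (k * m) (k * m) \<subseteq> B (k * m) 0 \<odot> B 0 (k * m)"
      by (simp only: l diff_self)
    then show ?thesis
      unfolding mult_map_surj_iff B_def by (simp add: int_mod.scale_right_distrib)
  qed
  moreover have "m > 0" using n by (simp add: m_def)
  ultimately show ?thesis using cones unfolding generating_pair_def by blast
qed

end

theorem theorem1p1:
  fixes scale :: "'k::alg_closed_field \<Rightarrow> 'a::idom \<Rightarrow> 'a"
    and A :: "'m::ab_group_add \<Rightarrow> 'a set"
  assumes "is_lattice TYPE('m)"
    and "graded_algebra scale A"
    and "finitely_generated_algebra scale"
  shows
    "(\<forall>u v. to_qtensor u \<in> weight_cone A \<and> to_qtensor v \<in> weight_cone A \<and> generating_pair A u v \<longrightarrow>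
        (\<exists>C\<in>GIT_fan A. to_qtensor u \<in> C \<and> to_qtensor v \<in> C)) \<and>
     (\<forall>u v. \<forall>C\<in>GIT_fan A.
        to_qtensor u \<in> weight_cone A \<and> to_qtensor v \<in> weight_cone A \<and>
        to_qtensor u \<in> C \<and> to_qtensor v \<in> C \<and> to_qtensor u \<in> rel_interior_Q C \<longrightarrow>
        generating_pair A u v)"
proof -
  interpret graded_algebra scale A by (rule assms(2))
  interpret fg_graded_domain scale A
    using assms(3) lattice_torsion_free[OF assms(1)] by unfold_locales
  show ?thesis
  proof (intro conjI allI ballI impI)
    fix u v assume asm: "to_qtensor u \<in> weight_cone A \<and> to_qtensor v \<in> weight_cone A \<and> generating_pair A u v"
    then have "to_qtensor (u + v) \<in> weight_cone A"
      unfolding to_qtensor_add weight_cone_def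
      using convex_cone_Q_hull unfolding convex_cone_Q_def by blast
    \<comment> \<open>The common cone is that of the sum: both weights lie in every orbit cone
      containing it.\<close>
    then have "GIT_cone A (to_qtensor (u + v)) \<in> GIT_fan A" unfolding GIT_fan_def by (rule imageI)
    moreover have "to_qtensor u \<in> GIT_cone A (to_qtensor (u + v))"
      "to_qtensor v \<in> GIT_cone A (to_qtensor (u + v))"
      using asm generating_pair_orbit_cones unfolding GIT_cone_def by blast+
    ultimately show "\<exists>C\<in>GIT_fan A. to_qtensor u \<in> C \<and> to_qtensor v \<in> C" by blast
  next
    fix u v C
    assume C: "C \<in> GIT_fan A" and asm: "to_qtensor u \<in> weight_cone A \<and> to_qtensor v \<in> weight_cone A \<and>
        to_qtensor u \<in> C \<and> to_qtensor v \<in> C \<and> to_qtensor u \<in> rel_interior_Q C"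
    obtain w where w: "w \<in> weight_cone A" "C = GIT_cone A w" using C unfolding GIT_fan_def by blast
    obtain k :: nat where k: "k > 0" "of_nat k \<cdot>\<^sub>Q to_qtensor u - to_qtensor v \<in> C"
      using rel_interior_Q_absorbs[of C "to_qtensor u" "to_qtensor v"] asm
        convex_cone_Q_GIT_cone[of w] w(2) by metis
    have diff: "to_qtensor (int k \<cdot>\<^sub>Z u - v) \<in> C"
      using k(2) by (simp add: to_qtensor_diff to_qtensor_scale)
    show "generating_pair A u v"
    proof (rule generating_pairI)
      fix x :: "'a set" assume x: "x \<in> closed_points"
      show "to_qtensor u \<in> orbit_cone A x" if "to_qtensor (u + v) \<in> orbit_cone A x"
        using GIT_cone_summand[OF w(1) _ _ x that] asm w(2) by blast
      assume "to_qtensor u \<in> orbit_cone A x"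
      then have "of_nat k \<cdot>\<^sub>Q to_qtensor u \<in> orbit_cone A x"
        unfolding orbit_cone_def using k(1)
        by (simp only: convex_cone_Q_scale_iff[OF convex_cone_Q_hull] of_nat_0_less_iff)
      then have "to_qtensor (v + (int k \<cdot>\<^sub>Z u - v)) \<in> orbit_cone A x"
        by (simp add: to_qtensor_scale)
      then show "to_qtensor v \<in> orbit_cone A x"
        using GIT_cone_summand[OF w(1) _ _ x] asm diff w(2) by blast
    qed (use asm in auto)
  qed
qed

end
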